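(* Let $\alpha$ be a finite alphabet with involutions $\tau,\nu:\alpha\to\alpha$ satisfying $\tau\nu=\nu\tau$, and let $S_\sharp=\{(a,a,a),(a,a,\nu\tau(a)),(a,\nu\tau(a),\nu\tau(a))\mid a\in\alpha\}$. Then the generalized Jones polynomial $J\circ\mathcal{F}_*$ is an $S_\sharp$-homotopy invariant of nanophrases over $\alpha$; that is, if $P$ and $P'$ are $S_\sharp$-homotopic nanophrases over $\alpha$, then $J(\mathcal{F}_*(P))=J(\mathcal{F}_*(P'))$.
   Context: **Nanophrases.** An alphabet is a finite set; an involution is a self-map whose square is the identity (possibly the identity). An $\alpha$-alphabet is a finite set $\mathcal{A}$ with a projection $\mathcal{A}\to\alpha$, $A\mapsto|A|$. A nanophrase of length $k$ over $\alpha$ is a pair $(\mathcal{A},P)$ with $\mathcal{A}$ an $\alpha$-alphabet and $P=w_1|\cdots|w_k$ a sequence of $k$ (possibly empty) words in $\mathcal{A}$ such that every letter of $\mathcal{A}$ occurs exactly twice in $w_1\cdots w_k$. Nanophrases are taken of length $k\ge1$. Isomorphism of nanophrases: a projection-preserving bijection of alphabets carrying components to corresponding components. **$S$-homotopy.** For an involution $\tau$ and $S\subset\alpha^3$, $S$-homotopy is the equivalence relation generated by isomorphisms and the moves (with $x,y,z,t$ words in the remaining letters, possibly containing the separator $|$): (H1) $(\mathcal{A},xAAy)\to(\mathcal{A}\setminus\{A\},xy)$; (H2) $(\mathcal{A},xAByBAz)\to(\mathcal{A}\setminus\{A,B\},xyz)$ if $\tau(|A|)=|B|$; (H3) $(\mathcal{A},xAByACzBCt)\to(\mathcal{A},xBAyCAzCBt)$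 if $(|A|,|B|,|C|)\in S$. **The map $\mathcal{F}_*$.** Let $\sim_{\tau,\nu}$ be the equivalence relation on $\alpha$ generated by $a\sim\tau(a)$, $a\sim\nu(a)$; fix a complete system of representatives $L$ and let $L_*=\{a\in L:a\ne\tau(a),a\ne\nu(a),\tau(a)\ne\nu(a)\}$, $\eta_*=L_*\cup\tau(L_* )\cup\nu(L_* )\cup\tau\nu(L_* )$. Let $\alpha_*=\{a_+,a_-,b_+,b_-\}$. $\mathcal{F}_*(\mathcal{A},P)$ is the nanophrase over $\alpha_*$ obtained by deleting (both occurrences of) all letters $A$ with $|A|\notin\eta_*$, keeping all separators, and giving each remaining letter $A$ the projection $a_+,b_+,a_-,b_-$ according as $|A|\in L_*,\nu(L_* ),\tau\nu(L_* ),\tau(L_* )$. **The Jones polynomial $J$.** For a nanophrase over $\alpha_*$, first replace projections by $a_+,b_+\mapsto1$, $a_-,b_-\mapsto-1$, obtaining a nanophrase over $\alpha_1=\{1,-1\}$; $J$ of the original is $J$ of this one. For a nanophrase $(\mathcal{A},P)$ over $\alpha_1$: - For a word $w$, $w^-$ is the word in the opposite order, and $Q_w$ denotes the phrase $Q$ with $|A|$ replaced by $-|A|$ for each letter $A$ occurring exactly once in $w$. - A state is a map $s=\mathrm{mark}:\mathcal{A}\to\{-1,1\}$. Phrases over $\alpha_1$ with a state are considered up to cyclic shifts of components (projections unchanged), permutations of components (projections unchanged), and inversions of a component (replace $w_i$ by $w_i^-$ and $|A|$ by $-|A|$ for each letter occurring exactly once in $w_i$); markers are unchanged by these. Using them,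 a letter $A$ is deleted by $w_1|\cdots|AxAy|\cdots|w_k\to w_1|\cdots|x|y|\cdots|w_k$ if $\mathrm{mark}(A)=|A|$, and $\to(w_1|\cdots|x^-y|\cdots|w_k)_x$ if $\mathrm{mark}(A)=-|A|$; $w_1|\cdots|Ax|Ay|\cdots|w_k\to w_1|\cdots|xy|\cdots|w_k$ if $\mathrm{mark}(A)=|A|$, and $\to(w_1|\cdots|x^-y|\cdots|w_k)_x$ if $\mathrm{mark}(A)=-|A|$. Deleting all letters gives $\emptyset|\cdots|\emptyset$, whose number of components is $|s|$ (independent of the order of deletion). - $\sigma(s)=\#\{A:\mathrm{mark}(A)=1\}-\#\{A:\mathrm{mark}(A)=-1\}$, $w(P)=\sum_{A\in\mathcal{A}}|A|$, and $$J(P)=(-t)^{-3w(P)}\sum_{s}t^{\sigma(s)}(-t^2-t^{-2})^{|s|-1}\in\mathbb{Z}[t,t^{-1}].$$ *)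

theory Defs
  imports Main "HOL-Library.FuncSet" "HOL-Library.Multiset" "HOL-Library.Poly_Mapping"
begin

text \<open>Letters are drawn from an arbitrary type \<open>'l\<close>; the alphabet of a phrase is a finite
  subset of it. The values of \<open>proj\<close> outside \<open>alph\<close> are irrelevant (isomorphisms below only
  look at the values on \<open>alph\<close>). Homotopies stay inside \<open>'l\<close>; taking \<open>'l\<close> to be \<open>nat\<close>, say,
  covers all nanophrases and homotopies up to relabelling of letters.\<close>

datatype ('l, 'a) phrase =
  Phrase (alph: "'l set") (proj: "'l \<Rightarrow> 'a") (comps: "'l list list")

definition nanophrase :: "'a set \<Rightarrow> ('l, 'a) phrase \<Rightarrow> bool" where
  "nanophrase \<alpha> P \<longleftrightarrow>
     finite (alph P) \<and> proj P ` alph P \<subseteq> \<alpha> \<and> comps P \<noteq> [] \<and>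
     set (concat (comps P)) \<subseteq> alph P \<and>
     (\<forall>A\<in>alph P. count_list (concat (comps P)) A = 2)"

definition isomorphic :: "('l, 'a) phrase \<Rightarrow> ('l, 'a) phrase \<Rightarrow> bool" where
  "isomorphic P P' \<longleftrightarrow>
     (\<exists>f. bij_betw f (alph P) (alph P') \<and>
          (\<forall>A\<in>alph P. proj P' (f A) = proj P A) \<and>
          comps P' = map (map f) (comps P))"

text \<open>The sequence \<open>w\<^sub>1|\<dots>|w\<^sub>k\<close> as one word in which \<open>None\<close> is the separator. It determines a
  nonempty list of components uniquely.\<close>

fun barred :: "'l list list \<Rightarrow> 'l option list" where
  "barred [] = []"
| "barred [w] = map Some w"
| "barred (w # v # ws) = map Some w @ None # barred (v # ws)"

text \<open>The moves are only used between nanophrases (see \<open>homotopic\<close>), where each letter occurs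
  exactly twice; hence the letters displayed are distinct and do not occur in \<open>x, y, z, t\<close>.\<close>

inductive move :: "('a \<Rightarrow> 'a) \<Rightarrow> ('a \<times> 'a \<times> 'a) set \<Rightarrow> ('l, 'a) phrase \<Rightarrow> ('l, 'a) phrase \<Rightarrow> bool"
  for \<tau> S where
  H1: "barred ws = x @ [Some A, Some A] @ y \<Longrightarrow>
       barred ws' = x @ y \<Longrightarrow>
       move \<tau> S (Phrase \<A> p ws) (Phrase (\<A> - {A}) p ws')"
| H2: "barred ws = x @ [Some A, Some B] @ y @ [Some B, Some A] @ z \<Longrightarrow>
       barred ws' = x @ y @ z \<Longrightarrow>
       \<tau> (p A) = p B \<Longrightarrow>
       move \<tau> S (Phrase \<A> p ws) (Phrase (\<A> - {A, B}) p ws')"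
| H3: "barred ws = x @ [Some A, Some B] @ y @ [Some A, Some C] @ z @ [Some B, Some C] @ t \<Longrightarrow>
       barred ws' = x @ [Some B, Some A] @ y @ [Some C, Some A] @ z @ [Some C, Some B] @ t \<Longrightarrow>
       (p A, p B, p C) \<in> S \<Longrightarrow>
       move \<tau> S (Phrase \<A> p ws) (Phrase \<A> p ws')"

definition homotopic ::
  "'a set \<Rightarrow> ('a \<Rightarrow> 'a) \<Rightarrow> ('a \<times> 'a \<times> 'a) set \<Rightarrow> ('l, 'a) phrase \<Rightarrow> ('l, 'a) phrase \<Rightarrow> bool" where
  "homotopic \<alpha> \<tau> S =
     equivclp (\<lambda>P P'. nanophrase \<alpha> P \<and> nanophrase \<alpha> P' \<and> (isomorphic P P' \<or> move \<tau> S P P'))"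

definition involution_on :: "'a set \<Rightarrow> ('a \<Rightarrow> 'a) \<Rightarrow> bool" where
  "involution_on \<alpha> \<tau> \<longleftrightarrow> \<tau> \<in> \<alpha> \<rightarrow> \<alpha> \<and> (\<forall>a\<in>\<alpha>. \<tau> (\<tau> a) = a)"

definition S_sharp :: "'a set \<Rightarrow> ('a \<Rightarrow> 'a) \<Rightarrow> ('a \<Rightarrow> 'a) \<Rightarrow> ('a \<times> 'a \<times> 'a) set" where
  "S_sharp \<alpha> \<tau> \<nu> =
     (\<Union>a\<in>\<alpha>. {(a, a, a), (a, a, \<nu> (\<tau> a)), (a, \<nu> (\<tau> a), \<nu> (\<tau> a))})"

definition orbit_equiv :: "'a set \<Rightarrow> ('a \<Rightarrow> 'a) \<Rightarrow> ('a \<Rightarrow> 'a) \<Rightarrow> 'a \<Rightarrow> 'a \<Rightarrow> bool" where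
  "orbit_equiv \<alpha> \<tau> \<nu> = equivclp (\<lambda>a b. a \<in> \<alpha> \<and> (b = \<tau> a \<or> b = \<nu> a))"

definition representatives :: "'a set \<Rightarrow> ('a \<Rightarrow> 'a) \<Rightarrow> ('a \<Rightarrow> 'a) \<Rightarrow> 'a set \<Rightarrow> bool" where
  "representatives \<alpha> \<tau> \<nu> L \<longleftrightarrow> L \<subseteq> \<alpha> \<and> (\<forall>a\<in>\<alpha>. \<exists>!l. l \<in> L \<and> orbit_equiv \<alpha> \<tau> \<nu> a l)"

definition L_star :: "('a \<Rightarrow> 'a) \<Rightarrow> ('a \<Rightarrow> 'a) \<Rightarrow> 'a set \<Rightarrow> 'a set" where
  "L_star \<tau> \<nu> L = {a \<in> L. a \<noteq> \<tau> a \<and> a \<noteq> \<nu> a \<and> \<tau> a \<noteq> \<nu> a}"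

definition eta_star :: "('a \<Rightarrow> 'a) \<Rightarrow> ('a \<Rightarrow> 'a) \<Rightarrow> 'a set \<Rightarrow> 'a set" where
  "eta_star \<tau> \<nu> L =
     L_star \<tau> \<nu> L \<union> \<tau> ` L_star \<tau> \<nu> L \<union> \<nu> ` L_star \<tau> \<nu> L \<union> (\<tau> \<circ> \<nu>) ` L_star \<tau> \<nu> L"

datatype alpha_star = a_plus | a_minus | b_plus | b_minus

text \<open>The four sets in the case distinction are pairwise disjoint, so its order is irrelevant.\<close>

definition F_star ::
  "('a \<Rightarrow> 'a) \<Rightarrow> ('a \<Rightarrow> 'a) \<Rightarrow> 'a set \<Rightarrow> ('l, 'a) phrase \<Rightarrow> ('l, alpha_star) phrase" where
  "F_star \<tau> \<nu> L P =
     Phrase {A \<in> alph P. proj P A \<in> eta_star \<tau> \<nu> L}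
       (\<lambda>A. if proj P A \<in> L_star \<tau> \<nu> L then a_plus
            else if proj P A \<in> \<nu> ` L_star \<tau> \<nu> L then b_plus
            else if proj P A \<in> (\<tau> \<circ> \<nu>) ` L_star \<tau> \<nu> L then a_minus
            else b_minus)
       (map (filter (\<lambda>A. proj P A \<in> eta_star \<tau> \<nu> L)) (comps P))"

text \<open>The alphabet \<open>{1, -1}\<close> is a subset of \<open>int\<close>. \<open>flip w p\<close> negates the projection of each
  letter that occurs exactly once in \<open>w\<close>.\<close>

definition flip :: "'l list \<Rightarrow> ('l \<Rightarrow> int) \<Rightarrow> 'l \<Rightarrow> int" where
  "flip w p = (\<lambda>A. if count_list w A = 1 then - p A else p A)"

text \<open>The steps on phrases with state \<open>m\<close>: cyclic shift, permutation and inversion of components,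
  and the four ways to delete a letter. The first three kinds of step are undone by further steps
  of the same kind, so it is enough to iterate in one direction.\<close>

inductive state_step ::
  "('l \<Rightarrow> int) \<Rightarrow> ('l \<Rightarrow> int) \<times> 'l list list \<Rightarrow> ('l \<Rightarrow> int) \<times> 'l list list \<Rightarrow> bool"
  for m where
  shift: "state_step m (p, us @ w # vs) (p, us @ rotate1 w # vs)"
| permute: "mset ws = mset ws' \<Longrightarrow> state_step m (p, ws) (p, ws')"
| invert: "state_step m (p, us @ w # vs) (flip w p, us @ rev w # vs)"
| delete_same: "m A = p A \<Longrightarrow>
    state_step m (p, us @ (A # x @ A # y) # vs) (p, us @ x # y # vs)"
| delete_same_twisted: "m A = - p A \<Longrightarrow>
    state_step m (p, us @ (A # x @ A # y) # vs) (flip x p, us @ (rev x @ y) # vs)"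
| delete_two: "m A = p A \<Longrightarrow>
    state_step m (p, us @ (A # x) # (A # y) # vs) (p, us @ (x @ y) # vs)"
| delete_two_twisted: "m A = - p A \<Longrightarrow>
    state_step m (p, us @ (A # x) # (A # y) # vs) (flip x p, us @ (rev x @ y) # vs)"

definition state_size :: "('l, int) phrase \<Rightarrow> ('l \<Rightarrow> int) \<Rightarrow> nat" where
  "state_size P s =
     (THE n. \<exists>p. (state_step s)\<^sup>*\<^sup>* (proj P, comps P) (p, replicate n []))"

definition states :: "('l, int) phrase \<Rightarrow> ('l \<Rightarrow> int) set" where
  "states P = alph P \<rightarrow>\<^sub>E {- 1, 1}"

definition state_sigma :: "('l, int) phrase \<Rightarrow> ('l \<Rightarrow> int) \<Rightarrow> int" where
  "state_sigma P s = int (card {A \<in> alph P. s A = 1}) - int (card {A \<in> alph P. s A = - 1})"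

definition writhe :: "('l, int) phrase \<Rightarrow> int" where
  "writhe P = (\<Sum>A\<in>alph P. proj P A)"

text \<open>The ring of integral Laurent polynomials in \<open>t\<close> is the group ring of the integers over the
  integers: finitely supported functions from exponents to coefficients under convolution.\<close>

type_synonym laurent = "int \<Rightarrow>\<^sub>0 int"

definition t_pow :: "int \<Rightarrow> laurent" where
  "t_pow n = Poly_Mapping.single n 1"

definition neg_t_pow :: "int \<Rightarrow> laurent" where \<comment> \<open>the \<open>n\<close>-th power of the unit \<open>-t\<close>\<close>
  "neg_t_pow n = (- 1) ^ nat \<bar>n\<bar> * t_pow n"

definition jones :: "('l, int) phrase \<Rightarrow> laurent" where
  "jones P = neg_t_pow (- 3 * writhe P) *
     (\<Sum>s\<in>states P. t_pow (state_sigma P s) * (- t_pow 2 - t_pow (- 2)) ^ (state_size P s - 1))"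

fun star_sign :: "alpha_star \<Rightarrow> int" where
  "star_sign a_plus = 1"
| "star_sign b_plus = 1"
| "star_sign a_minus = - 1"
| "star_sign b_minus = - 1"

definition jones_star :: "('l, alpha_star) phrase \<Rightarrow> laurent" where
  "jones_star P = jones (Phrase (alph P) (star_sign \<circ> proj P) (comps P))"

end

theory Submission
  imports Defs
begin

text \<open>Deleting all letters of a phrase with state reconnects, at every letter, the two strands that
  pass through it, and leaves a system of closed curves; \<open>|s|\<close> is the number of these curves. The
  proof rests on the following description of \<open>|s|\<close>. Colour every arc between consecutive letters
  with one of two colours so that arcs which are joined by the reconnection get the same colour.
  Every closed curve chooses its colour freely, so there are \<open>2\<close> to the power \<open>|s|\<close> colourings. Every
  deletion preserves the number of colourings, essentially bijectively
  (\<open>state_step_invariant\<close>); therefore \<open>|s|\<close> does not depend on the order of deletion, and it is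
  determined by a count that makes sense before anything is deleted (\<open>state_size_colourings\<close>).

  The count is organised as a state sum. A passage of a strand through a letter, with its two
  colours, is a commuting variable; a word becomes a product of two by two matrices of such
  variables, a component the trace of its word, a phrase the product of its components. The
  linear functional \<open>weight\<close> then retains those monomials in which the two passages of each letter
  are compatible with the state. Rotating, permuting and reversing components become the
  commutativity of the product, the cyclicity of the trace and transposition.

  A homotopy move changes only a few short strands, and the state sum is multilinear in the
  strands (\<open>closed_sum_linear\<close>). Hence it suffices to compare the local contributions of the
  strands, which is a finite table of functions of the colours at their ends (\<open>loc1_table\<close>,
  \<open>loc2_table\<close>, \<open>loc3_table\<close>). Read through these tables, invariance is Kauffman's bracket
  argument. For (H1) the two states of the letter add up to \<open>- t ^ (3 \<epsilon>)\<close>, where \<open>\<epsilon>\<close> is the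
  sign of the letter, and the factor with the writhe compensates this. For (H2) one of the four states
  gives the phrase without the two letters; the other three trace the same curves up to an
  additional circle in one of them, and their coefficients add up to zero. For (H3) four of the
  eight states on one side show a common pattern of curves that exactly one state on the other side
  shows, and conversely; the remaining three states match one to one. The coefficients fit
  (\<open>third_move_coefficients\<close>) for the triples of signs \<open>(\<epsilon>, \<epsilon>, \<epsilon>)\<close>, \<open>(\<epsilon>, \<epsilon>, - \<epsilon>)\<close> and
  \<open>(\<epsilon>, - \<epsilon>, - \<epsilon>)\<close>.

  Finally, on the letters kept by \<open>F_star\<close> the involution \<open>\<tau>\<close> reverses the sign and \<open>\<nu>\<close> preserves
  it. So a move over \<open>\<alpha>\<close> either disappears or becomes a move over \<open>{1, - 1}\<close> of one of the kinds
  just treated (\<open>sign_phrase_move\<close>).\<close>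

section \<open>Matrices over a commutative semiring\<close>

definition mmul :: "('i::finite \<Rightarrow> 'i \<Rightarrow> 'r::comm_semiring_1) \<Rightarrow> ('i \<Rightarrow> 'i \<Rightarrow> 'r) \<Rightarrow> 'i \<Rightarrow> 'i \<Rightarrow> 'r" where
  "mmul Q R = (\<lambda>i j. \<Sum>k\<in>UNIV. Q i k * R k j)"

definition mone :: "'i::finite \<Rightarrow> 'i \<Rightarrow> 'r::comm_semiring_1" where
  "mone = (\<lambda>i j. if i = j then 1 else 0)"

definition mprod :: "('i::finite \<Rightarrow> 'i \<Rightarrow> 'r::comm_semiring_1) list \<Rightarrow> 'i \<Rightarrow> 'i \<Rightarrow> 'r" where
  "mprod Qs = foldr mmul Qs mone"

definition mtrace :: "('i::finite \<Rightarrow> 'i \<Rightarrow> 'r::comm_semiring_1) \<Rightarrow> 'r" where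
  "mtrace Q = (\<Sum>i\<in>UNIV. Q i i)"

definition mtranspose :: "('i \<Rightarrow> 'i \<Rightarrow> 'r) \<Rightarrow> 'i \<Rightarrow> 'i \<Rightarrow> 'r" where
  "mtranspose Q = (\<lambda>i j. Q j i)"

lemma sum_delta_mult:
  fixes f :: "'i::finite \<Rightarrow> 'r::comm_semiring_1"
  shows "(\<Sum>k\<in>UNIV. (if i = k then 1 else 0) * f k) = f i"
    and "(\<Sum>k\<in>UNIV. f k * (if k = i then 1 else 0)) = f i"
proof -
  have "(\<Sum>k\<in>UNIV. (if i = k then 1 else 0) * f k) = (\<Sum>k\<in>UNIV. if i = k then f k else 0)"
    by (rule sum.cong) auto
  thus "(\<Sum>k\<in>UNIV. (if i = k then 1 else 0) * f k) = f i" by simp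
  have "(\<Sum>k\<in>UNIV. f k * (if k = i then 1 else 0)) = (\<Sum>k\<in>UNIV. if k = i then f k else 0)"
    by (rule sum.cong) auto
  thus "(\<Sum>k\<in>UNIV. f k * (if k = i then 1 else 0)) = f i" by simp
qed

lemma mmul_mone [simp]: "mmul mone Q = Q" "mmul Q mone = Q"
  by (auto simp: mmul_def mone_def fun_eq_iff sum_delta_mult)

lemma mmul_assoc: "mmul (mmul P Q) R = mmul P (mmul Q R)"
proof (intro ext)
  fix i j
  have "mmul (mmul P Q) R i j = (\<Sum>k\<in>UNIV. \<Sum>l\<in>UNIV. P i l * (Q l k * R k j))"
    by (simp add: mmul_def sum_distrib_right mult.assoc)
  also have "\<dots> = (\<Sum>l\<in>UNIV. \<Sum>k\<in>UNIV. P i l * (Q l k * R k j))"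
    by (rule sum.swap)
  also have "\<dots> = mmul P (mmul Q R) i j"
    by (simp add: mmul_def sum_distrib_left)
  finally show "mmul (mmul P Q) R i j = mmul P (mmul Q R) i j" .
qed

lemma mprod_simps [simp]:
  "mprod [] = mone"
  "mprod (Q # Qs) = mmul Q (mprod Qs)"
  by (simp_all add: mprod_def)

lemma mprod_append: "mprod (Qs @ Rs) = mmul (mprod Qs) (mprod Rs)"
  by (induction Qs) (simp_all add: mmul_assoc)

lemma mtrace_mmul_commute: "mtrace (mmul P Q) = mtrace (mmul Q P)"
proof -
  have "mtrace (mmul P Q) = (\<Sum>k\<in>UNIV. \<Sum>i\<in>UNIV. P i k * Q k i)"
    unfolding mtrace_def mmul_def by (rule sum.swap)
  thus ?thesis by (simp add: mtrace_def mmul_def mult.commute)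
qed

lemma mtranspose_mmul: "mtranspose (mmul P Q) = mmul (mtranspose Q) (mtranspose P)"
  by (simp add: mtranspose_def mmul_def mult.commute)

lemma mprod_rev: "mprod (rev Qs) = mtranspose (mprod (map mtranspose Qs))"
proof (induction Qs)
  case Nil
  show ?case by (auto simp: mtranspose_def mone_def fun_eq_iff)
next
  case (Cons Q Qs)
  have "mtranspose (mtranspose Q) = Q" by (simp add: mtranspose_def)
  thus ?case using Cons by (simp add: mprod_append mtranspose_mmul)
qed


section \<open>Formal sums of multisets\<close>

text \<open>Finitely supported functions from multisets to numbers are polynomials, the multisets being
  the monomials. Evaluating a function on monomials and extending linearly is written as an
  integral, because products turn into iterated integrals (\<open>integ_mult\<close>).\<close>

definition integ :: "('x \<Rightarrow>\<^sub>0 nat) \<Rightarrow> ('x \<Rightarrow> nat) \<Rightarrow> nat" where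
  "integ m k = (\<Sum>M\<in>Poly_Mapping.keys m. Poly_Mapping.lookup m M * k M)"

lemma integ_superset:
  assumes "finite S" "Poly_Mapping.keys m \<subseteq> S"
  shows "integ m k = (\<Sum>M\<in>S. Poly_Mapping.lookup m M * k M)"
  unfolding integ_def
  by (rule sum.mono_neutral_left) (use assms in \<open>auto simp: in_keys_iff\<close>)

lemma integ_zero [simp]: "integ 0 k = 0"
  by (simp add: integ_def)

lemma integ_add [simp]: "integ (m + n) k = integ m k + integ n k"
proof -
  let ?S = "Poly_Mapping.keys m \<union> Poly_Mapping.keys n"
  have "integ (m + n) k = (\<Sum>M\<in>?S. Poly_Mapping.lookup (m + n) M * k M)"
    by (rule integ_superset) (auto dest: subsetD[OF Poly_Mapping.keys_add])
  also have "\<dots> = (\<Sum>M\<in>?S. Poly_Mapping.lookup m M * k M) + (\<Sum>M\<in>?S. Poly_Mapping.lookup n M * k M)"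
    by (simp add: lookup_add algebra_simps sum.distrib)
  also have "\<dots> = integ m k + integ n k"
    by (simp add: integ_superset[of ?S])
  finally show ?thesis .
qed

lemma integ_sum: "integ (\<Sum>i\<in>I. m i) k = (\<Sum>i\<in>I. integ (m i) k)"
  by (induction I rule: infinite_finite_induct) auto

lemma integ_single [simp]: "integ (Poly_Mapping.single M c) k = c * k M"
  by (simp add: integ_def)

lemma integ_const_mult: "integ m (\<lambda>M. c * k M) = c * integ m k"
  by (simp add: integ_def sum_distrib_left mult.left_commute)

lemma integ_cong:
  "(\<And>M. M \<in> Poly_Mapping.keys m \<Longrightarrow> k M = k' M) \<Longrightarrow> integ m k = integ m k'"
  by (simp add: integ_def)

lemma poly_mapping_additive_induct [case_names zero single add]:
  fixes m :: "'x \<Rightarrow>\<^sub>0 nat"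
  assumes "P 0" "\<And>M c. P (Poly_Mapping.single M c)" "\<And>m n. P m \<Longrightarrow> P n \<Longrightarrow> P (m + n)"
  shows "P m"
proof (induction m rule: Poly_Mapping.update_induct)
  case const
  show ?case by (rule assms(1))
next
  case (update f a b)
  have "Poly_Mapping.update a b f = f + Poly_Mapping.single a b"
    using update.hyps(1)
    by (intro poly_mapping_eqI) (auto simp: lookup_update lookup_add lookup_single in_keys_iff)
  thus ?case using assms(2,3) update.IH by metis
qed

lemma integ_mult:
  fixes m n :: "'x multiset \<Rightarrow>\<^sub>0 nat"
  shows "integ (m * n) k = integ m (\<lambda>M. integ n (\<lambda>N. k (M + N)))"
proof (induction m rule: poly_mapping_additive_induct)
  case (single M c)
  show ?case
    by (induction n rule: poly_mapping_additive_induct)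
       (simp_all add: mult_single distrib_left)
qed (simp_all add: distrib_right)

text \<open>The multisets met below all arise by colouring the arcs of a fixed word, so they list the
  same letters; this is what allows a constraint to be evaluated one letter at a time.\<close>

definition graded :: "('x \<Rightarrow> 'l) \<Rightarrow> 'l multiset \<Rightarrow> ('x multiset \<Rightarrow>\<^sub>0 nat) \<Rightarrow> bool" where
  "graded f L m \<longleftrightarrow> (\<forall>M\<in>Poly_Mapping.keys m. image_mset f M = L)"

lemma graded_zero [simp]: "graded f L 0"
  by (simp add: graded_def)

lemma graded_one [simp]: "graded f {#} 1"
  by (simp add: graded_def)

lemma graded_sum: "(\<And>i. i \<in> I \<Longrightarrow> graded f L (m i)) \<Longrightarrow> graded f L (\<Sum>i\<in>I. m i)"
  unfolding graded_def using keys_sum[of m I] by blast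

lemma graded_mult: "graded f L m \<Longrightarrow> graded f L' n \<Longrightarrow> graded f (L + L') (m * n)"
  unfolding graded_def using keys_mult[of m n] by fastforce

lemma graded_single [simp]: "graded f (image_mset f M) (Poly_Mapping.single M c)"
  by (simp add: graded_def)

section \<open>Colourings of the arcs of a phrase\<close>

text \<open>A passage records the colours of the arcs before and after one occurrence of a letter.\<close>

type_synonym 'l passage = "bool \<times> 'l \<times> bool"

type_synonym 'l colour_sum = "'l passage multiset \<Rightarrow>\<^sub>0 nat"

definition letter :: "'l passage \<Rightarrow> 'l" where
  "letter t = fst (snd t)"

lemma letter_simp [simp]: "letter (c, A, d) = A"
  by (simp add: letter_def)

definition pass :: "'l \<Rightarrow> bool \<Rightarrow> bool \<Rightarrow> 'l colour_sum" where
  "pass A c d = Poly_Mapping.single {#(c, A, d)#} 1"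

definition word_mat :: "'l list \<Rightarrow> bool \<Rightarrow> bool \<Rightarrow> 'l colour_sum" where
  "word_mat w = mprod (map pass w)"

text \<open>The trace closes a word up to a component. The empty word has one arc and no letter, and indeed
  its trace is \<open>2\<close>.\<close>

definition circle_sum :: "'l list \<Rightarrow> 'l colour_sum" where
  "circle_sum w = mtrace (word_mat w)"

definition phrase_sum :: "'l list list \<Rightarrow> 'l colour_sum" where
  "phrase_sum ws = prod_list (map circle_sum ws)"

text \<open>The flag says whether the marker of the letter equals its sign. If it does, deletion joins the
  arc entering at either occurrence to the arc leaving at the other one; if it does not, it joins the
  two entering arcs and the two leaving arcs.\<close>

definition paired :: "bool \<Rightarrow> bool \<times> bool \<Rightarrow> bool \<times> bool \<Rightarrow> bool" where
  "paired b t u \<longleftrightarrow> (if b then fst t = snd u \<and> snd t = fst u else t = u)"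

text \<open>A letter that does not occur in the phrase imposes no condition; this is the case of the empty
  multiset and lets compatibility be stated for all letters at once.\<close>

definition compatible_at :: "bool \<Rightarrow> 'l \<Rightarrow> 'l passage multiset \<Rightarrow> bool" where
  "compatible_at b A K \<longleftrightarrow> K = {#} \<or>
     (\<exists>c d c' d'. K = {#(c, A, d), (c', A, d')#} \<and> paired b (c, d) (c', d'))"

definition compatible :: "('l \<Rightarrow> bool) \<Rightarrow> 'l passage multiset \<Rightarrow> bool" where
  "compatible ori M \<longleftrightarrow>
     (\<forall>A. compatible_at (ori A) A (filter_mset (\<lambda>t. letter t = A) M))"

definition weight :: "('l \<Rightarrow> bool) \<Rightarrow> 'l colour_sum \<Rightarrow> nat" where
  "weight ori m = integ m (\<lambda>M. of_bool (compatible ori M))"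

definition colourings :: "('l \<Rightarrow> bool) \<Rightarrow> 'l list list \<Rightarrow> nat" where
  "colourings ori ws = weight ori (phrase_sum ws)"

lemma weight_sum: "weight ori (\<Sum>i\<in>I. m i) = (\<Sum>i\<in>I. weight ori (m i))"
  by (simp add: weight_def integ_sum)

lemma weight_zero [simp]: "weight ori 0 = 0"
  by (simp add: weight_def)

lemma weight_add [simp]: "weight ori (m + n) = weight ori m + weight ori n"
  by (simp add: weight_def)

lemma graded_pass: "graded letter {#A#} (pass A c d)"
  using graded_single[of letter "{#(c, A, d)#}" 1] by (simp add: pass_def)

lemma graded_word_mat: "graded letter (mset w) (word_mat w c d)"
proof (induction w arbitrary: c)
  case Nil
  show ?case by (simp add: word_mat_def mone_def)
next
  case (Cons A w)
  have "graded letter ({#A#} + mset w) (pass A c k * word_mat w k d)" for k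
    by (intro graded_mult graded_pass Cons.IH)
  thus ?case by (simp add: word_mat_def mmul_def graded_sum)
qed

lemma graded_circle_sum: "graded letter (mset w) (circle_sum w)"
  by (simp add: circle_sum_def mtrace_def graded_sum graded_word_mat)

lemma graded_phrase_sum: "graded letter (mset (concat ws)) (phrase_sum ws)"
  by (induction ws) (simp_all add: phrase_sum_def graded_mult graded_circle_sum)

lemma paired_commute: "paired b t u \<longleftrightarrow> paired b u t"
  by (auto simp: paired_def)

lemma compatible_at_empty [simp]: "compatible_at b A {#}"
  by (simp add: compatible_at_def)

lemma compatible_at_pair [simp]:
  "compatible_at b A {#(x, A, y), (x', A, y')#} \<longleftrightarrow> paired b (x, y) (x', y')"
  by (auto simp: compatible_at_def add_eq_conv_ex paired_commute)

lemma filter_letter_empty: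
  "filter_mset (\<lambda>t. letter t = A) M = {#} \<longleftrightarrow> A \<notin># image_mset letter M"
  by (induction M) auto

\<comment> \<open>Equations with an empty multiset of passages shall stay usable as rewrite rules.\<close>
declare filter_mset_eq_mempty_iff [simp del]

lemma weight_cong:
  assumes "graded letter L m" "\<And>A. A \<in># L \<Longrightarrow> ori A = ori' A"
  shows "weight ori m = weight ori' m"
  unfolding weight_def
proof (rule integ_cong)
  fix M assume "M \<in> Poly_Mapping.keys m"
  hence L: "image_mset letter M = L" using assms(1) by (simp add: graded_def)
  have "compatible_at (ori A) A (filter_mset (\<lambda>t. letter t = A) M) =
        compatible_at (ori' A) A (filter_mset (\<lambda>t. letter t = A) M)" for A
  proof (cases "A \<in># L")
    case True
    thus ?thesis using assms(2) by simp
  next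
    case False
    hence "filter_mset (\<lambda>t. letter t = A) M = {#}" using L filter_letter_empty[of A M] by simp
    thus ?thesis by (simp only: compatible_at_empty)
  qed
  hence "compatible ori M = compatible ori' M"
    by (simp only: compatible_def)
  thus "of_bool (compatible ori M) = (of_bool (compatible ori' M) :: nat)" by simp
qed

lemma compatible_add:
  assumes "A \<notin># image_mset letter M"
  shows "compatible ori ({#(c, A, d), (c', A, d')#} + M) \<longleftrightarrow>
         paired (ori A) (c, d) (c', d') \<and> compatible ori M"
proof -
  let ?N = "{#(c, A, d), (c', A, d')#}"
  let ?ok = "\<lambda>M B. compatible_at (ori B) B (filter_mset (\<lambda>t. letter t = B) M)"
  have *: "filter_mset (\<lambda>t. letter t = A) M = {#}"
    using assms filter_letter_empty by metis
  have all: "(\<forall>B. if B = A then R else Q B) \<longleftrightarrow> R \<and> (\<forall>B. Q B)" if "Q A" for R and Q :: "'a \<Rightarrow> bool"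
    using that by metis
  have ok: "?ok (?N + M) B \<longleftrightarrow> (if B = A then paired (ori A) (c, d) (c', d') else ?ok M B)" for B
    using * by (cases "B = A") simp_all
  have "?ok M A" using * by (simp only: compatible_at_empty)
  thus ?thesis unfolding compatible_def ok by (rule all)
qed

text \<open>No monomial of \<open>m\<close> has a passage through \<open>A\<close>, so the condition at \<open>A\<close> concerns the two new
  passages alone, and these do not affect the conditions at other letters.\<close>

lemma weight_pass_pass:
  assumes "graded letter L m" "A \<notin># L"
  shows "weight ori (pass A c d * (pass A c' d' * m)) =
         of_bool (paired (ori A) (c, d) (c', d')) * weight ori m"
proof -
  have "weight ori (pass A c d * (pass A c' d' * m)) =
        integ m (\<lambda>M. of_bool (compatible ori ({#(c, A, d), (c', A, d')#} + M)))"
    by (simp add: weight_def integ_mult pass_def add_mset_commute)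
  also have "\<dots> = integ m (\<lambda>M. of_bool (paired (ori A) (c, d) (c', d')) * of_bool (compatible ori M))"
  proof (rule integ_cong)
    fix M assume "M \<in> Poly_Mapping.keys m"
    hence "A \<notin># image_mset letter M" using assms by (simp add: graded_def)
    from compatible_add[OF this, of ori c d c' d']
    show "(of_bool (compatible ori ({#(c, A, d), (c', A, d')#} + M)) :: nat) =
        of_bool (paired (ori A) (c, d) (c', d')) * of_bool (compatible ori M)" by simp
  qed
  finally show ?thesis by (simp add: weight_def integ_const_mult)
qed

text \<open>Substituting other variables for the passages commutes with expanding the product. This serves
  for reversal, where \<open>h\<close> interchanges colours, and for renaming letters.\<close>

lemma integ_mprod_image:
  "integ (mprod (map (\<lambda>A c d. Poly_Mapping.single {#h (c, A, d)#} 1) w) c d) k =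
   integ (word_mat w c d) (\<lambda>M. k (image_mset h M))"
proof (induction w arbitrary: c k)
  case Nil
  show ?case by (simp add: word_mat_def mone_def flip: single_one)
next
  case (Cons A w)
  show ?case
    using Cons.IH by (simp add: word_mat_def mmul_def integ_sum integ_mult pass_def)
qed

text \<open>Reading a word backwards interchanges the two colours of every passage: a transposed product is
  the product of the transposes in the opposite order.\<close>

lemma integ_word_mat_rev:
  "integ (word_mat (rev w) c d) k =
   integ (word_mat w d c) (\<lambda>M. k (image_mset (\<lambda>(a, A, b). (b, A, a)) M))"
proof -
  have "word_mat (rev w) c d = mprod (map (mtranspose \<circ> pass) w) d c"
    by (simp add: word_mat_def mprod_rev mtranspose_def[of "mprod _"] flip: rev_map)
  also have "map (mtranspose \<circ> pass) w =
      map (\<lambda>A c d. Poly_Mapping.single {#(\<lambda>(a, A, b). (b, A, a)) (c, A, d)#} 1) w"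
    by (simp add: mtranspose_def pass_def fun_eq_iff)
  finally show ?thesis by (simp only: integ_mprod_image)
qed

lemma integ_phrase_sum_map:
  "integ (phrase_sum (map (map f) ws)) k =
   integ (phrase_sum ws) (\<lambda>M. k (image_mset (\<lambda>(a, A, b). (a, f A, b)) M))"
proof (induction ws arbitrary: k)
  case Nil
  show ?case by (simp add: phrase_sum_def flip: single_one)
next
  case (Cons w ws)
  have "integ (circle_sum (map f w)) k =
        integ (circle_sum w) (\<lambda>M. k (image_mset (\<lambda>(a, A, b). (a, f A, b)) M))" for k
    using integ_mprod_image[of "\<lambda>(a, A, b). (a, f A, b)" w _ _ k]
    by (simp add: circle_sum_def mtrace_def integ_sum word_mat_def comp_def pass_def[abs_def])
  thus ?case using Cons.IH by (simp add: phrase_sum_def integ_mult)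
qed

section \<open>Reducing a phrase with state does not change its number of colourings\<close>

lemma filter_letter_size:
  "size (filter_mset (\<lambda>t. letter t = A) M) = count (image_mset letter M) A"
  by (induction M) auto

lemma filter_letter_Suc0:
  assumes "count (image_mset letter M) A = 1"
  obtains c d where "filter_mset (\<lambda>t. letter t = A) M = {#(c, A, d)#}"
proof -
  obtain t where t: "filter_mset (\<lambda>t. letter t = A) M = {#t#}"
    using assms filter_letter_size[of A M] size_1_singleton_mset by metis
  hence "t \<in># filter_mset (\<lambda>t. letter t = A) M" by simp
  hence "letter t = A" by simp
  thus thesis using that t by (cases t) auto
qed

lemma filter_letter_2:
  assumes "count (image_mset letter M) A = 2"
  obtains c d c' d' where "filter_mset (\<lambda>t. letter t = A) M = {#(c, A, d), (c', A, d')#}"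
proof -
  let ?K = "filter_mset (\<lambda>t. letter t = A) M"
  have K: "size ?K = Suc (Suc 0)"
    using assms filter_letter_size[of A M] by simp
  obtain t K' where tK': "?K = add_mset t K'"
    using size_eq_Suc_imp_eq_union[OF K] by blast
  have "size K' = 1" using K unfolding tK' by simp
  then obtain u where "K' = {#u#}" using size_1_singleton_mset by blast
  hence t: "?K = {#t, u#}" using tK' by simp
  hence "t \<in># filter_mset (\<lambda>t. letter t = A) M" "u \<in># filter_mset (\<lambda>t. letter t = A) M" by simp_all
  hence "letter t = A" "letter u = A" by simp_all
  thus thesis using that t by (cases t, cases u) auto
qed

text \<open>Reversing the component \<open>x\<close> interchanges the colours of its passages. If both occurrences of a
  letter are affected, its condition is unchanged; if only one is, the two kinds of condition are
  interchanged, which is exactly what negating the sign of the letter undoes.\<close>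

lemma compatible_reverse:
  assumes M: "image_mset letter M = mset x" and N: "image_mset letter N = L"
    and two: "\<And>A. A \<in> set x \<Longrightarrow> count (mset x) A + count L A = 2"
    and ori': "\<And>A. A \<in> set x \<or> A \<in># L \<Longrightarrow> ori' A = (if count (mset x) A = 1 then \<not> ori A else ori A)"
  shows "compatible ori' (image_mset (\<lambda>(a, A, b). (b, A, a)) M + N) \<longleftrightarrow> compatible ori (M + N)"
proof -
  let ?r = "\<lambda>(a, A, b). (b, A, a)"
  let ?f = "\<lambda>A. filter_mset (\<lambda>t. letter t = A)"
  have r: "?f A (image_mset ?r M) = image_mset ?r (?f A M)" for A
    by (induction M) (auto split: prod.splits)
  have "compatible_at (ori' A) A (?f A (image_mset ?r M + N)) \<longleftrightarrow>
        compatible_at (ori A) A (?f A (M + N))" for A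
  proof (cases "A \<in> set x")
    case False
    hence "?f A M = {#}" using M filter_letter_empty[of A M] by simp
    moreover have "?f A N = {#}" if "A \<notin># L"
      using N that filter_letter_empty[of A N] by metis
    moreover have "ori' A = ori A" if "A \<in># L"
      using ori'[of A] that False by (simp add: count_mset)
    ultimately show ?thesis using r by (cases "A \<in># L") simp_all
  next
    case True
    have "count (mset x) A \<noteq> 0" using True by (simp add: count_eq_zero_iff)
    hence "count (mset x) A = 1 \<and> count L A = 1 \<or> count (mset x) A = 2 \<and> count L A = 0"
      using two[OF True] by linarith
    thus ?thesis
    proof (elim disjE conjE)
      assume c: "count (mset x) A = 1" "count L A = 1"
      then obtain a b a' b' where "?f A M = {#(a, A, b)#}" "?f A N = {#(a', A, b')#}"
        using M N filter_letter_Suc0[of M A] filter_letter_Suc0[of N A] by metis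
      moreover have "ori' A = (\<not> ori A)" using ori'[of A] True c by simp
      ultimately show ?thesis using r by (auto simp: paired_def)
    next
      assume c: "count (mset x) A = 2" "count L A = 0"
      then obtain a b a' b' where "?f A M = {#(a, A, b), (a', A, b')#}"
        using M filter_letter_2[of M A] by metis
      moreover have "?f A N = {#}" using N c(2) filter_letter_empty[of A N] by (metis count_eq_zero_iff)
      moreover have "ori' A = ori A" using ori'[of A] True c by simp
      ultimately show ?thesis using r by (auto simp: paired_def)
    qed
  qed
  thus ?thesis by (simp add: compatible_def)
qed

lemma weight_word_mat_rev:
  assumes "graded letter L n"
    and "\<And>A. A \<in> set x \<Longrightarrow> count (mset x) A + count L A = 2"
    and "\<And>A. A \<in> set x \<or> A \<in># L \<Longrightarrow> ori' A = (if count (mset x) A = 1 then \<not> ori A else ori A)"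
  shows "weight ori' (word_mat (rev x) c d * n) = weight ori (word_mat x d c * n)"
proof -
  let ?r = "\<lambda>(a, A, b). (b, A, a)"
  have "weight ori' (word_mat (rev x) c d * n) = integ (word_mat x d c)
      (\<lambda>M. integ n (\<lambda>N. of_bool (compatible ori' (image_mset ?r M + N))))"
    by (simp add: weight_def integ_mult integ_word_mat_rev)
  also have "\<dots> = integ (word_mat x d c) (\<lambda>M. integ n (\<lambda>N. of_bool (compatible ori (M + N))))"
  proof (intro integ_cong)
    fix M N assume "M \<in> Poly_Mapping.keys (word_mat x d c)" "N \<in> Poly_Mapping.keys n"
    hence "image_mset letter M = mset x" "image_mset letter N = L"
      using assms(1) graded_word_mat[of x d c] by (auto simp: graded_def)
    from compatible_reverse[OF this assms(2,3)]
    show "of_bool (compatible ori' (image_mset ?r M + N)) = (of_bool (compatible ori (M + N)) :: nat)"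
      by simp
  qed
  finally show ?thesis by (simp add: weight_def integ_mult)
qed

lemma phrase_sum_split: "phrase_sum (us @ w # vs) = circle_sum w * phrase_sum (us @ vs)"
  by (simp add: phrase_sum_def mult.left_commute)

lemma circle_sum_append_commute: "circle_sum (u @ v) = circle_sum (v @ u)"
  by (simp add: circle_sum_def word_mat_def mprod_append mtrace_mmul_commute)

lemma word_mat_append: "word_mat (u @ v) = mmul (word_mat u) (word_mat v)"
  by (simp add: word_mat_def mprod_append)

lemma word_mat_Cons: "word_mat (A # w) = mmul (pass A) (word_mat w)"
  by (simp add: word_mat_def)

text \<open>The two occurrences of a letter lie on one component, respectively on two. In both cases the
  sum over the four colours next to these occurrences can be written out.\<close>

lemma weight_same_component:
  assumes "graded letter L n" "A \<notin># L" "A \<notin> set x" "A \<notin> set y"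
  shows "weight ori (circle_sum (A # x @ A # y) * n) =
    (\<Sum>a\<in>UNIV. \<Sum>b\<in>UNIV. weight ori ((if ori A then word_mat x b b * word_mat y a a
                                         else word_mat x b a * word_mat y b a) * n))"
proof -
  have "circle_sum (A # x @ A # y) * n = (\<Sum>a\<in>UNIV. \<Sum>b\<in>UNIV. \<Sum>c\<in>UNIV. \<Sum>d\<in>UNIV.
      pass A a b * (pass A c d * (word_mat x b c * word_mat y d a * n)))"
    by (simp add: circle_sum_def mtrace_def word_mat_append word_mat_Cons mmul_def
        sum_distrib_left sum_distrib_right mult_ac)
  moreover have "graded letter (mset x + mset y + L) (word_mat x b c * word_mat y d a * n)" for a b c d
    by (intro graded_mult graded_word_mat assms)
  hence "weight ori (pass A a b * (pass A c d * (word_mat x b c * word_mat y d a * n))) =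
     of_bool (paired (ori A) (a, b) (c, d)) * weight ori (word_mat x b c * word_mat y d a * n)" for a b c d
    by (rule weight_pass_pass) (use assms in auto)
  ultimately show ?thesis
    by (simp add: weight_sum UNIV_bool paired_def)
qed

lemma weight_two_components:
  assumes "graded letter L n" "A \<notin># L" "A \<notin> set x" "A \<notin> set y"
  shows "weight ori (circle_sum (A # x) * circle_sum (A # y) * n) =
    (\<Sum>a\<in>UNIV. \<Sum>b\<in>UNIV. weight ori ((if ori A then word_mat x b a * word_mat y a b
                                         else word_mat x b a * word_mat y b a) * n))"
proof -
  have "circle_sum (A # x) * circle_sum (A # y) * n = (\<Sum>a\<in>UNIV. \<Sum>b\<in>UNIV. \<Sum>c\<in>UNIV. \<Sum>d\<in>UNIV.
      pass A a b * (pass A c d * (word_mat x b a * word_mat y d c * n)))"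
    by (simp add: circle_sum_def mtrace_def word_mat_Cons mmul_def
        sum_distrib_left sum_distrib_right mult_ac UNIV_bool algebra_simps)
  moreover have "graded letter (mset x + mset y + L) (word_mat x b a * word_mat y d c * n)" for a b c d
    by (intro graded_mult graded_word_mat assms)
  hence "weight ori (pass A a b * (pass A c d * (word_mat x b a * word_mat y d c * n))) =
     of_bool (paired (ori A) (a, b) (c, d)) * weight ori (word_mat x b a * word_mat y d c * n)" for a b c d
    by (rule weight_pass_pass) (use assms in auto)
  ultimately show ?thesis
    by (simp add: weight_sum UNIV_bool paired_def)
qed

lemma circle_sum_append: "circle_sum (x @ y) = (\<Sum>a\<in>UNIV. \<Sum>b\<in>UNIV. word_mat x a b * word_mat y b a)"
  by (simp add: circle_sum_def mtrace_def word_mat_append mmul_def)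

text \<open>The condition on the letters under which a state step is a genuine reconnection: the letter
  deleted has no third occurrence, and its marker is either its sign or the opposite.\<close>

definition balanced :: "('l \<Rightarrow> int) \<Rightarrow> ('l \<Rightarrow> int) \<Rightarrow> 'l multiset \<Rightarrow> bool" where
  "balanced m p L \<longleftrightarrow> (\<forall>A. A \<in># L \<longrightarrow> count L A = 2 \<and> (p A = 1 \<or> p A = - 1) \<and> (m A = 1 \<or> m A = - 1))"

lemma balanced_deletion:
  assumes "balanced m p L'" "L' = {#A, A#} + L"
  shows "A \<notin># L" and "balanced m p L"
proof -
  have "A \<in># L'" using assms(2) by simp
  hence "count L' A = 2" using assms(1) by (simp only: balanced_def)
  hence "count L A = 0" using assms(2) by simp
  thus A: "A \<notin># L" by (simp add: count_eq_zero_iff)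
  show "balanced m p L"
    unfolding balanced_def
  proof (intro allI impI)
    fix B assume B: "B \<in># L"
    hence "B \<in># L'" using assms(2) by simp
    with assms(1) have "count L' B = 2 \<and> (p B = 1 \<or> p B = - 1) \<and> (m B = 1 \<or> m B = - 1)"
      by (simp only: balanced_def)
    moreover have "B \<noteq> A" using A B by blast
    hence "count L' B = count L B" using assms(2) by simp
    ultimately show "count L B = 2 \<and> (p B = 1 \<or> p B = - 1) \<and> (m B = 1 \<or> m B = - 1)" by simp
  qed
qed

lemma flip_count: "flip w p A = (if count (mset w) A = 1 then - p A else p A)"
  by (simp add: flip_def count_mset)

lemma balanced_flip:
  assumes "balanced m p L"
  shows "balanced m (flip w p) L"
  unfolding balanced_def
proof (intro allI impI)
  fix A assume "A \<in># L"
  with assms have "count L A = 2 \<and> (p A = 1 \<or> p A = - 1) \<and> (m A = 1 \<or> m A = - 1)"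
    by (simp only: balanced_def)
  thus "count L A = 2 \<and> (flip w p A = 1 \<or> flip w p A = - 1) \<and> (m A = 1 \<or> m A = - 1)"
    by (auto simp: flip_count)
qed

text \<open>Reversing \<open>x\<close> and changing the signs of the letters occurring once in it have cancelling
  effects on the constraints.\<close>

lemma weight_rev_append:
  assumes bal: "balanced m p (mset x + mset y + L)" and n: "graded letter L n"
  shows "weight (\<lambda>A. m A = flip x p A) (circle_sum (rev x @ y) * n) =
    (\<Sum>a\<in>UNIV. \<Sum>b\<in>UNIV. weight (\<lambda>A. m A = p A) (word_mat x b a * word_mat y b a * n))"
proof -
  let ?L = "mset x + mset y + L"
  have g: "graded letter (mset y + L) (word_mat y b a * n)" for a b
    by (intro graded_mult graded_word_mat n)
  have two: "count (mset x) A + count (mset y + L) A = 2" if "A \<in> set x" for A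
  proof -
    have "A \<in># ?L" using that by simp
    hence "count ?L A = 2" using bal by (simp only: balanced_def)
    thus ?thesis by simp
  qed
  have ori: "(m A = flip x p A) = (if count (mset x) A = 1 then \<not> m A = p A else m A = p A)"
    if "A \<in> set x \<or> A \<in># mset y + L" for A
  proof -
    have "A \<in># ?L" using that by auto
    hence "(p A = 1 \<or> p A = - 1) \<and> (m A = 1 \<or> m A = - 1)" using bal by (simp only: balanced_def)
    thus ?thesis by (auto simp: flip_count)
  qed
  have "weight (\<lambda>A. m A = flip x p A) (word_mat (rev x) a b * (word_mat y b a * n)) =
      weight (\<lambda>A. m A = p A) (word_mat x b a * (word_mat y b a * n))" for a b
    by (rule weight_word_mat_rev[OF g two ori])
  thus ?thesis
    by (simp add: circle_sum_append sum_distrib_right weight_sum mult.assoc)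
qed
lemma phrase_sum_split_second: "phrase_sum (us @ v # w # vs) = circle_sum v * circle_sum w * phrase_sum (us @ vs)"
  by (simp add: phrase_sum_def ac_simps)

lemma balanced_twisted:
  assumes "balanced m p ({#A, A#} + L)"
  shows "p A \<noteq> 0" and "m A = p A \<or> m A = - p A"
proof -
  have "A \<in># {#A, A#} + L" by simp
  hence "(p A = 1 \<or> p A = - 1) \<and> (m A = 1 \<or> m A = - 1)"
    using assms by (simp only: balanced_def)
  thus "p A \<noteq> 0" "m A = p A \<or> m A = - p A" by auto
qed

lemma colourings_permute: "mset ws = mset ws' \<Longrightarrow> colourings ori ws = colourings ori ws'"
  unfolding colourings_def phrase_sum_def
  by (metis mset_map prod_mset_prod_list)

text \<open>Deleting a letter sums over the colours of the four arcs around its two occurrences; the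
  condition on them identifies these arcs in pairs, and what remains is the sum for the phrase after
  the deletion.\<close>

lemma state_step_invariant:
  assumes "state_step m P P'" "balanced m (fst P) (mset (concat (snd P)))"
  shows "balanced m (fst P') (mset (concat (snd P'))) \<and>
    colourings (\<lambda>A. m A = fst P A) (snd P) = colourings (\<lambda>A. m A = fst P' A) (snd P')"
  using assms
proof (induction P P' rule: state_step.induct)
  case (shift p us w vs)
  have "circle_sum (rotate1 w) = circle_sum w"
  proof (cases w)
    case (Cons A u)
    thus ?thesis using circle_sum_append_commute[of u "[A]"] by simp
  qed simp
  moreover have "mset (concat (us @ rotate1 w # vs)) = mset (concat (us @ w # vs))"
    by (cases w) simp_all
  ultimately show ?case
    using shift by (simp add: colourings_def phrase_sum_split)
next
  case (permute ws ws' p)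
  have "mset (concat ws) = sum_mset (image_mset mset (mset ws))" for ws :: "'a list list"
    by (induction ws) auto
  hence "mset (concat ws) = mset (concat ws')"
    using permute(1) by metis
  thus ?case
    using permute(2) colourings_permute[OF permute(1)] by simp
next
  case (invert p us w vs)
  let ?n = "phrase_sum (us @ vs)" and ?L = "mset (concat (us @ vs))"
  have bal: "balanced m p (mset w + mset [] + ?L)"
    using invert by (simp add: ac_simps)
  have "weight (\<lambda>A. m A = flip w p A) (circle_sum (rev w @ []) * ?n) =
      (\<Sum>a\<in>UNIV. \<Sum>b\<in>UNIV. weight (\<lambda>A. m A = p A) (word_mat w b a * word_mat [] b a * ?n))"
    by (rule weight_rev_append[OF bal graded_phrase_sum])
  also have "\<dots> = weight (\<lambda>A. m A = p A) (circle_sum w * ?n)"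
    by (simp add: circle_sum_def mtrace_def word_mat_def mone_def UNIV_bool distrib_right)
  finally show ?case
    using balanced_flip[OF bal, of w] by (simp add: colourings_def phrase_sum_split ac_simps)
next
  case (delete_same A p us x y vs)
  let ?n = "phrase_sum (us @ vs)" and ?L = "mset (concat (us @ vs))"
  have "mset (concat (us @ (A # x @ A # y) # vs)) = {#A, A#} + (mset x + mset y + ?L)"
    by simp
  note bal = balanced_deletion[OF delete_same(2)[unfolded fst_conv snd_conv] this]
  from bal(1) have A: "A \<notin># ?L" "A \<notin> set x" "A \<notin> set y" by simp_all
  have "weight (\<lambda>A. m A = p A) (circle_sum (A # x @ A # y) * ?n) =
      weight (\<lambda>A. m A = p A) (circle_sum x * (circle_sum y * ?n))"
    unfolding weight_same_component[OF graded_phrase_sum A]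
    using delete_same(1)
    by (simp add: circle_sum_def mtrace_def UNIV_bool algebra_simps)
  thus ?case
    using bal(2) by (simp add: colourings_def phrase_sum_split phrase_sum_split_second ac_simps)
next
  case (delete_same_twisted A p us x y vs)
  let ?n = "phrase_sum (us @ vs)" and ?L = "mset (concat (us @ vs))"
  have L: "mset (concat (us @ (A # x @ A # y) # vs)) = {#A, A#} + (mset x + mset y + ?L)"
    by simp
  note bal = balanced_deletion[OF delete_same_twisted(2)[unfolded fst_conv snd_conv] this]
  from bal(1) have A: "A \<notin># ?L" "A \<notin> set x" "A \<notin> set y" by simp_all
  have "m A \<noteq> p A"
    using balanced_twisted[OF delete_same_twisted(2)[unfolded fst_conv snd_conv L]]
      delete_same_twisted(1) by simp
  hence "weight (\<lambda>A. m A = p A) (circle_sum (A # x @ A # y) * ?n) =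
      (\<Sum>a\<in>UNIV. \<Sum>b\<in>UNIV. weight (\<lambda>A. m A = p A) (word_mat x b a * word_mat y b a * ?n))"
    unfolding weight_same_component[OF graded_phrase_sum A] by simp
  also have "\<dots> = weight (\<lambda>A. m A = flip x p A) (circle_sum (rev x @ y) * ?n)"
    by (rule weight_rev_append[OF bal(2) graded_phrase_sum, symmetric])
  finally show ?case
    using balanced_flip[OF bal(2), of x] by (simp add: colourings_def phrase_sum_split ac_simps)
next
  case (delete_two A p us x y vs)
  let ?n = "phrase_sum (us @ vs)" and ?L = "mset (concat (us @ vs))"
  have "mset (concat (us @ (A # x) # (A # y) # vs)) = {#A, A#} + (mset x + mset y + ?L)"
    by simp
  note bal = balanced_deletion[OF delete_two(2)[unfolded fst_conv snd_conv] this]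
  from bal(1) have A: "A \<notin># ?L" "A \<notin> set x" "A \<notin> set y" by simp_all
  have "weight (\<lambda>A. m A = p A) (circle_sum (A # x) * circle_sum (A # y) * ?n) =
      weight (\<lambda>A. m A = p A) (circle_sum (x @ y) * ?n)"
    unfolding weight_two_components[OF graded_phrase_sum A]
    using delete_two(1)
    by (simp add: circle_sum_append UNIV_bool algebra_simps)
  thus ?case
    using bal(2) by (simp add: colourings_def phrase_sum_split phrase_sum_split_second ac_simps)
next
  case (delete_two_twisted A p us x y vs)
  let ?n = "phrase_sum (us @ vs)" and ?L = "mset (concat (us @ vs))"
  have L: "mset (concat (us @ (A # x) # (A # y) # vs)) = {#A, A#} + (mset x + mset y + ?L)"
    by simp
  note bal = balanced_deletion[OF delete_two_twisted(2)[unfolded fst_conv snd_conv] this]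
  from bal(1) have A: "A \<notin># ?L" "A \<notin> set x" "A \<notin> set y" by simp_all
  have "m A \<noteq> p A"
    using balanced_twisted[OF delete_two_twisted(2)[unfolded fst_conv snd_conv L]]
      delete_two_twisted(1) by simp
  hence "weight (\<lambda>A. m A = p A) (circle_sum (A # x) * circle_sum (A # y) * ?n) =
      (\<Sum>a\<in>UNIV. \<Sum>b\<in>UNIV. weight (\<lambda>A. m A = p A) (word_mat x b a * word_mat y b a * ?n))"
    unfolding weight_two_components[OF graded_phrase_sum A] by simp
  also have "\<dots> = weight (\<lambda>A. m A = flip x p A) (circle_sum (rev x @ y) * ?n)"
    by (rule weight_rev_append[OF bal(2) graded_phrase_sum, symmetric])
  finally show ?case
    using balanced_flip[OF bal(2), of x]
    by (simp add: colourings_def phrase_sum_split phrase_sum_split_second ac_simps)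
qed

lemma state_steps_invariant:
  assumes "(state_step m)\<^sup>*\<^sup>* P P'" "balanced m (fst P) (mset (concat (snd P)))"
  shows "balanced m (fst P') (mset (concat (snd P'))) \<and>
    colourings (\<lambda>A. m A = fst P A) (snd P) = colourings (\<lambda>A. m A = fst P' A) (snd P')"
  using assms by (induction rule: rtranclp_induct) (auto dest: state_step_invariant)

lemma state_step_nonempty: "state_step m P P' \<Longrightarrow> snd P \<noteq> [] \<Longrightarrow> snd P' \<noteq> []"
  by (induction rule: state_step.induct) auto

lemma state_steps_nonempty: "(state_step m)\<^sup>*\<^sup>* P P' \<Longrightarrow> snd P \<noteq> [] \<Longrightarrow> snd P' \<noteq> []"
  by (induction rule: rtranclp_induct) (auto dest: state_step_nonempty)

text \<open>After all deletions only free circles remain, each with a free choice of its colour.\<close>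

lemma colourings_empty_words: "colourings ori (replicate n []) = 2 ^ n"
proof -
  have two: "(2 :: 'a colour_sum) = Poly_Mapping.single {#} 2"
    by (simp flip: single_numeral)
  have "(2 :: 'a colour_sum) ^ n = Poly_Mapping.single {#} (2 ^ n)"
  proof (induction n)
    case (Suc n)
    show ?case unfolding power_Suc Suc by (subst two, subst mult_single) simp
  qed (simp flip: single_one)
  moreover have "phrase_sum (replicate n []) = (2 :: 'a colour_sum) ^ n"
    by (simp add: phrase_sum_def circle_sum_def mtrace_def word_mat_def mone_def UNIV_bool)
  ultimately have "phrase_sum (replicate n []) = (Poly_Mapping.single {#} (2 ^ n) :: 'a colour_sum)"
    by (simp only:)
  thus ?thesis by (simp add: colourings_def weight_def compatible_def)
qed

lemma state_steps_rotate:
  "(state_step m)\<^sup>*\<^sup>* (p, us @ (x @ y) # vs) (p, us @ (y @ x) # vs)"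
proof (induction x arbitrary: y)
  case (Cons A x)
  have "state_step m (p, us @ (A # x @ y) # vs) (p, us @ rotate1 (A # x @ y) # vs)"
    by (rule state_step.shift)
  hence "state_step m (p, us @ ((A # x) @ y) # vs) (p, us @ (x @ y @ [A]) # vs)" by simp
  also have "(state_step m)\<^sup>*\<^sup>* (p, us @ (x @ y @ [A]) # vs) (p, us @ ((y @ [A]) @ x) # vs)"
    by (rule Cons.IH)
  finally show ?case by simp
qed simp

text \<open>As long as letters remain, rotations and permutations bring one of them to the front.\<close>

lemma state_steps_delete:
  assumes "balanced m p (mset (concat ws))" "concat ws \<noteq> []"
  obtains q ws' where "(state_step m)\<^sup>*\<^sup>* (p, ws) (q, ws')"
    "length (concat ws') < length (concat ws)"
proof -
  obtain A where A: "A \<in> set (concat ws)"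
    using assms(2) by (metis last_in_set)
  then obtain w where w: "w \<in> set ws" "A \<in> set w" by auto
  obtain us vs where ws: "ws = us @ w # vs" using w(1) by (auto dest: split_list)
  obtain x y where wxy: "w = x @ A # y" using w(2) by (auto dest: split_list)
  have "(state_step m)\<^sup>*\<^sup>* (p, ws) (p, us @ ((A # y) @ x) # vs)"
    unfolding ws wxy by (rule state_steps_rotate)
  hence front: "(state_step m)\<^sup>*\<^sup>* (p, ws) (p, us @ (A # y @ x) # vs)" by simp
  have sign: "m A = p A \<or> m A = - p A"
    using assms(1) A unfolding balanced_def by (metis minus_equation_iff set_mset_mset)
  have len: "length (concat ws) = Suc (length (concat us) + length x + length y + length (concat vs))"
    by (simp add: ws wxy)
  have "count (mset (concat ws)) A = 2" using assms(1) A unfolding balanced_def by (metis set_mset_mset)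
  hence "count (mset (concat (us @ (y @ x) # vs))) A = 1" by (simp add: ws wxy)
  hence "A \<in># mset (concat (us @ (y @ x) # vs))" by (metis count_greater_zero_iff zero_less_one)
  hence "A \<in> set (y @ x) \<or> (\<exists>v\<in>set (us @ vs). A \<in> set v)" by auto
  thus thesis
  proof (elim disjE bexE)
    assume "A \<in> set (y @ x)"
    then obtain u v where uv: "y @ x = u @ A # v" by (meson split_list)
    hence luv: "length y + length x = Suc (length u + length v)"
      by (metis add_Suc_right length_Cons length_append)
    have "state_step m (p, us @ (A # u @ A # v) # vs) (p, us @ u # v # vs) \<or>
          state_step m (p, us @ (A # u @ A # v) # vs) (flip u p, us @ (rev u @ v) # vs)"
      using sign state_step.delete_same state_step.delete_same_twisted by metis
    thus thesis
    proof
      assume "state_step m (p, us @ (A # u @ A # v) # vs) (p, us @ u # v # vs)"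
      with front uv have "(state_step m)\<^sup>*\<^sup>* (p, ws) (p, us @ u # v # vs)" by simp
      thus thesis by (rule that) (use len luv in simp)
    next
      assume "state_step m (p, us @ (A # u @ A # v) # vs) (flip u p, us @ (rev u @ v) # vs)"
      with front uv have "(state_step m)\<^sup>*\<^sup>* (p, ws) (flip u p, us @ (rev u @ v) # vs)" by simp
      thus thesis by (rule that) (use len luv in simp)
    qed
  next
    fix v assume v: "v \<in> set (us @ vs)" "A \<in> set v"
    obtain us' vs' where usvs: "us @ vs = us' @ v # vs'" using v(1) by (meson split_list)
    obtain x' y' where vxy: "v = x' @ A # y'" using v(2) by (auto dest: split_list)
    have "mset (us @ (A # y @ x) # vs) = mset (([A # y @ x] @ us') @ (x' @ A # y') # vs')"
      using arg_cong[OF usvs, of mset] by (simp add: vxy)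
    hence "state_step m (p, us @ (A # y @ x) # vs) (p, ([A # y @ x] @ us') @ (x' @ A # y') # vs')"
      by (rule state_step.permute)
    also have "(state_step m)\<^sup>*\<^sup>* (p, ([A # y @ x] @ us') @ (x' @ A # y') # vs')
        (p, ([A # y @ x] @ us') @ ((A # y') @ x') # vs')"
      by (rule state_steps_rotate)
    also have "state_step m (p, ([A # y @ x] @ us') @ ((A # y') @ x') # vs')
         (p, [] @ (A # y @ x) # (A # y' @ x') # us' @ vs')"
      by (rule state_step.permute) simp
    finally have two: "(state_step m)\<^sup>*\<^sup>* (p, ws) (p, [] @ (A # y @ x) # (A # y' @ x') # us' @ vs')"
      using front by simp
    have "length (concat us) + length (concat vs) = length (concat (us' @ v # vs'))"
      by (simp flip: usvs)
    hence l: "length (concat us) + length (concat vs) =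
        Suc (length (concat us') + length x' + length y' + length (concat vs'))"
      by (simp add: vxy)
    have "state_step m (p, [] @ (A # y @ x) # (A # y' @ x') # us' @ vs')
           (p, [] @ ((y @ x) @ (y' @ x')) # us' @ vs') \<or>
          state_step m (p, [] @ (A # y @ x) # (A # y' @ x') # us' @ vs')
           (flip (y @ x) p, [] @ (rev (y @ x) @ (y' @ x')) # us' @ vs')"
      using sign state_step.delete_two state_step.delete_two_twisted by metis
    thus thesis
    proof
      assume "state_step m (p, [] @ (A # y @ x) # (A # y' @ x') # us' @ vs')
           (p, [] @ ((y @ x) @ (y' @ x')) # us' @ vs')"
      with two have "(state_step m)\<^sup>*\<^sup>* (p, ws) (p, [] @ ((y @ x) @ (y' @ x')) # us' @ vs')"
        by (rule rtranclp.rtrancl_into_rtrancl)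
      thus thesis by (rule that) (use len l in simp)
    next
      assume "state_step m (p, [] @ (A # y @ x) # (A # y' @ x') # us' @ vs')
           (flip (y @ x) p, [] @ (rev (y @ x) @ (y' @ x')) # us' @ vs')"
      with two have "(state_step m)\<^sup>*\<^sup>* (p, ws) (flip (y @ x) p, [] @ (rev (y @ x) @ (y' @ x')) # us' @ vs')"
        by (rule rtranclp.rtrancl_into_rtrancl)
      thus thesis by (rule that) (use len l in simp)
    qed
  qed
qed

lemma state_steps_terminate:
  assumes "balanced m p (mset (concat ws))"
  shows "\<exists>q n. (state_step m)\<^sup>*\<^sup>* (p, ws) (q, replicate n [])"
  using assms
proof (induction "length (concat ws)" arbitrary: p ws rule: less_induct)
  case less
  show ?case
  proof (cases "concat ws = []")
    case True
    hence "\<forall>w\<in>set ws. w = []" by simp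
    hence "ws = replicate (length ws) []" by (metis replicate_length_same)
    thus ?thesis by (metis rtranclp.rtrancl_refl)
  next
    case False
    then obtain q ws' where s: "(state_step m)\<^sup>*\<^sup>* (p, ws) (q, ws')"
      "length (concat ws') < length (concat ws)"
      using state_steps_delete less.prems by metis
    have "balanced m q (mset (concat ws'))" using state_steps_invariant[OF s(1)] less.prems by simp
    with less.hyps[OF s(2)] s(1) show ?thesis by (meson rtranclp_trans)
  qed
qed

text \<open>Any complete sequence of deletions ends in \<open>n\<close> empty words with \<open>2 ^ n\<close> equal to the number of
  colourings, so \<open>n\<close> is unique. Positivity is needed because the exponent of the loop value in the
  Jones polynomial is \<open>|s| - 1\<close>, a truncated difference.\<close>

lemma state_size_colourings:
  assumes "nanophrase {-1, 1} P" "s \<in> states P"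
  shows "2 ^ state_size P s = colourings (\<lambda>A. s A = proj P A) (comps P)"
    and "state_size P s > 0"
proof -
  have b: "balanced s (proj P) (mset (concat (comps P)))"
    unfolding balanced_def
  proof (intro allI impI)
    fix A assume "A \<in># mset (concat (comps P))"
    hence A: "A \<in> alph P" using assms(1) unfolding nanophrase_def by (metis set_mset_mset subsetD)
    moreover have "proj P A \<in> {-1, 1}" using A assms(1) unfolding nanophrase_def by blast
    moreover have "s A \<in> {-1, 1}" using A assms(2) unfolding states_def by blast
    ultimately show "count (mset (concat (comps P))) A = 2 \<and> (proj P A = 1 \<or> proj P A = - 1) \<and>
        (s A = 1 \<or> s A = - 1)"
      using assms(1) by (auto simp: nanophrase_def count_mset)
  qed
  have *: "2 ^ n = colourings (\<lambda>A. s A = proj P A) (comps P)"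
    if "(state_step s)\<^sup>*\<^sup>* (proj P, comps P) (q, replicate n [])" for q n
    using state_steps_invariant[OF that] b by (simp add: colourings_empty_words)
  obtain q n where n: "(state_step s)\<^sup>*\<^sup>* (proj P, comps P) (q, replicate n [])"
    using state_steps_terminate[OF b] by blast
  have "state_size P s = n"
    unfolding state_size_def
  proof (rule the_equality)
    fix n' assume "\<exists>p. (state_step s)\<^sup>*\<^sup>* (proj P, comps P) (p, replicate n' [])"
    hence "(2::nat) ^ n' = 2 ^ n" using * n by metis
    thus "n' = n" by simp
  qed (use n in blast)
  moreover have "n > 0"
    using state_steps_nonempty[OF n] assms(1) by (cases n) (auto simp: nanophrase_def)
  ultimately show "2 ^ state_size P s = colourings (\<lambda>A. s A = proj P A) (comps P)"
    "state_size P s > 0" using *[OF n] by simp_all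
qed


section \<open>Cutting strands out of a phrase\<close>

type_synonym 'r strand = "bool \<Rightarrow> bool \<Rightarrow> 'r"

text \<open>A barred word is scanned from left to right, remembering the colour at which the current
  component began and the current colour. A separator requires the two to agree and restarts with an
  arbitrary colour. In place of letters, arbitrary two by two matrices are allowed, so that strands
  of several letters can be treated as single symbols.\<close>

fun step :: "'r::comm_semiring_1 strand option \<Rightarrow> bool \<times> bool \<Rightarrow> bool \<times> bool \<Rightarrow> 'r" where
  "step (Some Q) (b, c) (b', c') = (if b = b' then Q c c' else 0)"
| "step None (b, c) (b', c') = (if b = c \<and> b' = c' then 1 else 0)"

definition scan :: "'r::comm_semiring_1 strand option list \<Rightarrow> bool \<times> bool \<Rightarrow> bool \<times> bool \<Rightarrow> 'r" where
  "scan W = mprod (map step W)"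

definition closed_sum :: "'r::comm_semiring_1 strand option list \<Rightarrow> 'r" where
  "closed_sum W = (\<Sum>b\<in>UNIV. \<Sum>b'\<in>UNIV. scan W (b, b) (b', b'))"

definition strands :: "'l option list \<Rightarrow> 'l colour_sum strand option list" where
  "strands W = map (map_option pass) W"

lemma scan_append: "scan (U @ V) = mmul (scan U) (scan V)"
  by (simp add: scan_def mprod_append)

lemma scan_Nil [simp]: "scan [] = mone"
  by (simp add: scan_def)

lemma scan_Cons: "scan (q # V) = mmul (step q) (scan V)"
  by (simp add: scan_def)

lemma sum_pairs:
  fixes f :: "bool \<times> bool \<Rightarrow> 'r::comm_monoid_add"
  shows "(\<Sum>r\<in>UNIV. f r) = (\<Sum>b\<in>UNIV. \<Sum>c\<in>UNIV. f (b, c))"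
  by (simp add: sum.cartesian_product flip: UNIV_Times_UNIV)

lemma scan_word: "scan (strands (map Some w)) (b, c) (b', c') = (if b = b' then word_mat w c c' else 0)"
proof (induction w arbitrary: b c)
  case Nil
  show ?case by (simp add: strands_def word_mat_def mone_def)
next
  case (Cons A w)
  have "scan (strands (map Some (A # w))) (b, c) (b', c') =
      (\<Sum>e\<in>UNIV. \<Sum>d\<in>UNIV. step (Some (pass A)) (b, c) (e, d) * (if e = b' then word_mat w d c' else 0))"
    using Cons.IH by (simp add: strands_def scan_Cons mmul_def sum_pairs del: UNIV_bool)
  also have "\<dots> = (if b = b' then word_mat (A # w) c c' else 0)"
    by (cases b; cases b') (simp_all add: UNIV_bool word_mat_Cons mmul_def)
  finally show ?case .
qed

lemma closed_sum_word: "closed_sum (strands (map Some w)) = circle_sum w"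
  by (simp add: closed_sum_def scan_word circle_sum_def mtrace_def)

lemma strands_append: "strands (U @ V) = strands U @ strands V"
  by (simp add: strands_def)

lemma closed_sum_separator:
  "closed_sum (strands (map Some w @ None # W)) = circle_sum w * closed_sum (strands W)"
proof -
  have "closed_sum (strands (map Some w @ None # W)) =
     (\<Sum>b\<in>UNIV. \<Sum>b'\<in>UNIV. \<Sum>e\<in>UNIV. word_mat w b b * scan (strands W) (e, e) (b', b'))"
    unfolding strands_append
    by (simp add: closed_sum_def scan_append scan_word strands_def[of "None # _"] scan_Cons
       mmul_def sum_pairs UNIV_bool distrib_left flip: strands_def)
  thus ?thesis
    by (simp add: closed_sum_def circle_sum_def mtrace_def UNIV_bool algebra_simps)
qed

lemma closed_sum_barred: "ws \<noteq> [] \<Longrightarrow> closed_sum (strands (barred ws)) = phrase_sum ws"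
  by (induction ws rule: barred.induct)
     (simp_all add: closed_sum_word closed_sum_separator phrase_sum_def)

definition unit_strand :: "bool \<Rightarrow> bool \<Rightarrow> 'r::comm_semiring_1 strand" where
  "unit_strand c e = (\<lambda>c' e'. if c = c' \<and> e = e' then 1 else 0)"

text \<open>Every matrix is the combination of the elementary matrices with its entries as coefficients,
  and scanning is linear in each symbol.\<close>

lemma closed_sum_linear:
  "closed_sum (U @ Some Q # V) =
     (\<Sum>c\<in>UNIV. \<Sum>e\<in>UNIV. Q c e * closed_sum (U @ Some (unit_strand c e) # V))"
proof -
  define f where "f S = (\<Sum>b\<in>UNIV. \<Sum>b'\<in>UNIV. \<Sum>r\<in>UNIV. \<Sum>s\<in>UNIV.
      scan U (b, b) r * S r s * scan V s (b', b'))" for S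
  have f: "closed_sum (U @ Some R # V) = f (step (Some R))" for R
    by (simp add: closed_sum_def scan_append scan_Cons mmul_def f_def sum_distrib_left mult.assoc)
  have add: "f (\<lambda>r s. S r s + S' r s) = f S + f S'" for S S'
    by (simp add: f_def algebra_simps sum.distrib)
  have scale: "f (\<lambda>r s. a * S r s) = a * f S" for a S
    by (simp add: f_def sum_distrib_left ac_simps)
  let ?u = "\<lambda>c e. step (Some (unit_strand c e :: 'a strand))"
  have "step (Some Q) = (\<lambda>r s.
      (Q False False * ?u False False r s + Q False True * ?u False True r s) +
      (Q True False * ?u True False r s + Q True True * ?u True True r s))"
    by (intro ext) (auto simp: unit_strand_def)
  thus ?thesis by (simp add: f add scale UNIV_bool ac_simps)
qed

lemma step_mmul: "step (Some (mmul P Q)) = mmul (step (Some P)) (step (Some Q))"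
  by (intro ext) (auto simp: mmul_def sum_pairs UNIV_bool)

lemma step_mone: "step (Some mone) = mone"
  by (intro ext) (auto simp: mone_def split: if_splits)

lemma closed_sum_merge:
  "closed_sum (U @ Some P # Some Q # V) = closed_sum (U @ Some (mmul P Q) # V)"
  by (simp add: closed_sum_def scan_append scan_Cons step_mmul mmul_assoc)

text \<open>An empty strand is the same as a strand on which the colour does not change.\<close>

lemma closed_sum_insert_mone: "closed_sum (U @ V) = closed_sum (U @ Some mone # V)"
  by (simp add: closed_sum_def scan_append scan_Cons step_mone)

abbreviation letters :: "'l option list \<Rightarrow> 'l multiset" where
  "letters W \<equiv> mset (List.map_filter (\<lambda>u. u) W)"

lemma letters_simps [simp]:
  "letters [] = {#}" "letters (Some A # W) = add_mset A (letters W)" "letters (None # W) = letters W"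
  "letters (U @ V) = letters U + letters V"
  by (simp_all add: List.map_filter_def)

lemma letters_map_Some [simp]: "letters (map Some w) = mset w"
  by (induction w) simp_all

lemma letters_barred: "letters (barred ws) = mset (concat ws)"
  by (induction ws rule: barred.induct) simp_all

definition graded_scan :: "'l multiset \<Rightarrow> 'l colour_sum strand option list \<Rightarrow> bool" where
  "graded_scan L W \<longleftrightarrow> (\<forall>r s. graded letter L (scan W r s))"

lemma graded_scan_append:
  "graded_scan L U \<Longrightarrow> graded_scan L' V \<Longrightarrow> graded_scan (L + L') (U @ V)"
  unfolding graded_scan_def scan_append mmul_def by (auto intro!: graded_sum graded_mult)

lemma graded_scan_strands: "graded_scan (letters W) (strands W)"
proof (induction W)
  case Nil
  show ?case by (simp add: graded_scan_def strands_def mone_def)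
next
  case (Cons u W)
  have "graded_scan (letters [u]) (strands [u])"
  proof (cases u)
    case None
    show ?thesis
      unfolding graded_scan_def by (auto simp: None strands_def scan_def split: prod.splits)
  next
    case (Some A)
    show ?thesis
      unfolding graded_scan_def by (auto simp: Some strands_def scan_def intro: graded_pass)
  qed
  from graded_scan_append[OF this Cons.IH] show ?case by (cases u) (simp_all add: strands_def)
qed

lemma graded_scan_unit_strand: "graded_scan L V \<Longrightarrow> graded_scan L (Some (unit_strand c e) # V)"
proof -
  have "graded_scan {#} [Some (unit_strand c e)]"
    unfolding graded_scan_def by (auto simp: scan_def unit_strand_def)
  from graded_scan_append[OF this] show "graded_scan L V \<Longrightarrow> ?thesis" by simp
qed

lemma graded_closed_sum: "graded_scan L W \<Longrightarrow> graded letter L (closed_sum W)"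
  by (simp add: closed_sum_def graded_scan_def graded_sum)

section \<open>The local contributions of the homotopy moves\<close>

text \<open>What remains of a phrase when one, two or three strands are cut out of it, with prescribed
  colours at the beginning and the end of each of these strands.\<close>

definition ctx1 where
  "ctx1 x y c e = closed_sum (strands x @ Some (unit_strand c e) # strands y)"

definition ctx2 where
  "ctx2 x y z c e c' e' = closed_sum (strands x @ Some (unit_strand c e) # strands y @
     Some (unit_strand c' e') # strands z)"

definition ctx3 where
  "ctx3 x y z t c e c' e' c'' e'' = closed_sum (strands x @ Some (unit_strand c e) # strands y @
     Some (unit_strand c' e') # strands z @ Some (unit_strand c'' e'') # strands t)"

lemma closed_sum_ctx1:
  "closed_sum (strands x @ Some Q # strands y) = (\<Sum>c\<in>UNIV. \<Sum>e\<in>UNIV. Q c e * ctx1 x y c e)"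
  unfolding ctx1_def by (rule closed_sum_linear)

lemma closed_sum_ctx2:
  "closed_sum (strands x @ Some Q # strands y @ Some R # strands z) =
   (\<Sum>c\<in>UNIV. \<Sum>e\<in>UNIV. \<Sum>c'\<in>UNIV. \<Sum>e'\<in>UNIV. Q c e * (R c' e' * ctx2 x y z c e c' e'))"
proof -
  have inner: "closed_sum (strands x @ Some P # strands y @ Some R # strands z) =
      (\<Sum>c'\<in>UNIV. \<Sum>e'\<in>UNIV. R c' e' *
        closed_sum (strands x @ Some P # strands y @ Some (unit_strand c' e') # strands z))" for P
    using closed_sum_linear[of "strands x @ Some P # strands y" R "strands z"] by simp
  show ?thesis
    by (subst closed_sum_linear, subst inner) (simp add: sum_distrib_left ctx2_def)
qed

lemma closed_sum_ctx3:
  "closed_sum (strands x @ Some Q # strands y @ Some R # strands z @ Some S # strands t) =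
   (\<Sum>c\<in>UNIV. \<Sum>e\<in>UNIV. \<Sum>c'\<in>UNIV. \<Sum>e'\<in>UNIV. \<Sum>c''\<in>UNIV. \<Sum>e''\<in>UNIV.
      Q c e * (R c' e' * (S c'' e'' * ctx3 x y z t c e c' e' c'' e'')))"
proof -
  have inner: "closed_sum (strands x @ Some P # strands y @ Some P' # strands z @ Some S # strands t) =
      (\<Sum>c''\<in>UNIV. \<Sum>e''\<in>UNIV. S c'' e'' * closed_sum (strands x @ Some P # strands y @
         Some P' # strands z @ Some (unit_strand c'' e'') # strands t))" for P P'
    using closed_sum_linear[of "strands x @ Some P # strands y @ Some P' # strands z" S "strands t"]
    by simp
  have middle: "closed_sum (strands x @ Some P # strands y @ Some R # strands z @ Some S # strands t) =
      (\<Sum>c'\<in>UNIV. \<Sum>e'\<in>UNIV. R c' e' * closed_sum (strands x @ Some P # strands y @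
         Some (unit_strand c' e') # strands z @ Some S # strands t))" for P
    using closed_sum_linear[of "strands x @ Some P # strands y" R "strands z @ Some S # strands t"]
    by simp
  show ?thesis
    by (subst closed_sum_linear, subst middle, subst inner) (simp add: sum_distrib_left ctx3_def)
qed

lemma graded_ctx1: "graded letter (letters (x @ y)) (ctx1 x y c e)"
  unfolding ctx1_def letters_simps
  by (intro graded_closed_sum graded_scan_append graded_scan_unit_strand graded_scan_strands)

lemma graded_ctx2: "graded letter (letters (x @ y @ z)) (ctx2 x y z c e c' e')"
  unfolding ctx2_def letters_simps
  by (intro graded_closed_sum graded_scan_append graded_scan_unit_strand graded_scan_strands)

lemma graded_ctx3: "graded letter (letters (x @ y @ z @ t)) (ctx3 x y z t c e c' e' c'' e'')"
  unfolding ctx3_def letters_simps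
  by (intro graded_closed_sum graded_scan_append graded_scan_unit_strand graded_scan_strands)

definition barred_weight :: "('l \<Rightarrow> bool) \<Rightarrow> 'l option list \<Rightarrow> nat" where
  "barred_weight ori W = weight ori (closed_sum (strands W))"

lemma barred_weight: "ws \<noteq> [] \<Longrightarrow> colourings ori ws = barred_weight ori (barred ws)"
  by (simp add: barred_weight_def colourings_def closed_sum_barred)

lemma weight_one_letter:
  assumes "graded letter L n" "A \<notin># L"
  shows "weight ori (mmul (pass A) (pass A) c e * n) =
    (\<Sum>d\<in>UNIV. of_bool (paired (ori A) (c, d) (d, e))) * weight ori n"
  using weight_pass_pass[OF assms]
  by (simp add: mmul_def sum_distrib_right weight_sum mult.assoc)

lemma weight_two_letters:
  assumes n: "graded letter L n" and A: "A \<notin># L" and B: "B \<notin># L" "A \<noteq> B"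
  shows "weight ori (pass A a1 a2 * (pass A a3 a4 * (pass B b1 b2 * (pass B b3 b4 * n)))) =
    of_bool (paired (ori A) (a1, a2) (a3, a4)) * of_bool (paired (ori B) (b1, b2) (b3, b4)) * weight ori n"
proof -
  have "graded letter ({#B#} + ({#B#} + L)) (pass B b1 b2 * (pass B b3 b4 * n))"
    by (intro graded_mult graded_pass n)
  from weight_pass_pass[OF this] show ?thesis
    using weight_pass_pass[OF n B(1)] A B by simp
qed

lemma weight_three_letters:
  assumes n: "graded letter L n" and L: "A \<notin># L" "B \<notin># L" "C \<notin># L" and d: "A \<noteq> B" "A \<noteq> C" "B \<noteq> C"
  shows "weight ori (pass A a1 a2 * (pass A a3 a4 * (pass B b1 b2 * (pass B b3 b4 *
      (pass C c1 c2 * (pass C c3 c4 * n)))))) =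
    of_bool (paired (ori A) (a1, a2) (a3, a4)) * of_bool (paired (ori B) (b1, b2) (b3, b4)) *
    of_bool (paired (ori C) (c1, c2) (c3, c4)) * weight ori n"
proof -
  have "graded letter ({#C#} + ({#C#} + L)) (pass C c1 c2 * (pass C c3 c4 * n))"
    by (intro graded_mult graded_pass n)
  from weight_two_letters[OF this] show ?thesis
    using weight_pass_pass[OF n L(3)] L d by simp
qed

text \<open>The numbers of admissible colours for the interior arcs of the strands that take part in a move,
  given the colours at the ends of the strands.\<close>

definition loc1 :: "bool \<Rightarrow> bool \<Rightarrow> bool \<Rightarrow> nat" where
  "loc1 oA c e = (\<Sum>d\<in>UNIV. of_bool (paired oA (c, d) (d, e)))"

definition loc2 :: "bool \<Rightarrow> bool \<Rightarrow> bool \<Rightarrow> bool \<Rightarrow> bool \<Rightarrow> bool \<Rightarrow> nat" where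
  "loc2 oA oB c e c' e' = (\<Sum>d'\<in>UNIV. \<Sum>d\<in>UNIV.
     of_bool (paired oA (c, d) (d', e')) * of_bool (paired oB (d, e) (c', d')))"

definition loc3_left :: "bool \<Rightarrow> bool \<Rightarrow> bool \<Rightarrow>
    bool \<Rightarrow> bool \<Rightarrow> bool \<Rightarrow> bool \<Rightarrow> bool \<Rightarrow> bool \<Rightarrow> nat" where
  "loc3_left oA oB oC c e c' e' c'' e'' = (\<Sum>d''\<in>UNIV. \<Sum>d'\<in>UNIV. \<Sum>d\<in>UNIV.
     of_bool (paired oA (c, d) (c', d')) * of_bool (paired oB (d, e) (c'', d'')) *
     of_bool (paired oC (d', e') (d'', e'')))"

definition loc3_right :: "bool \<Rightarrow> bool \<Rightarrow> bool \<Rightarrow>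
    bool \<Rightarrow> bool \<Rightarrow> bool \<Rightarrow> bool \<Rightarrow> bool \<Rightarrow> bool \<Rightarrow> nat" where
  "loc3_right oA oB oC c e c' e' c'' e'' = (\<Sum>d''\<in>UNIV. \<Sum>d'\<in>UNIV. \<Sum>d\<in>UNIV.
     of_bool (paired oA (d, e) (d', e')) * of_bool (paired oB (c, d) (d'', e'')) *
     of_bool (paired oC (c', d') (c'', d'')))"

lemma barred_weight_H1:
  assumes "A \<notin># letters (x @ y)"
  shows "barred_weight ori (x @ [Some A, Some A] @ y) =
    (\<Sum>c\<in>UNIV. \<Sum>e\<in>UNIV. loc1 (ori A) c e * weight ori (ctx1 x y c e))"
proof -
  have "strands (x @ [Some A, Some A] @ y) = strands x @ Some (pass A) # Some (pass A) # strands y"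
    by (simp add: strands_def)
  hence "closed_sum (strands (x @ [Some A, Some A] @ y)) =
    (\<Sum>c\<in>UNIV. \<Sum>e\<in>UNIV. mmul (pass A) (pass A) c e * ctx1 x y c e)"
    by (simp only: closed_sum_merge closed_sum_ctx1)
  thus ?thesis
    by (simp only: barred_weight_def weight_sum weight_one_letter[OF graded_ctx1 assms] loc1_def)
qed

lemma barred_weight_H1':
  "barred_weight ori (x @ y) = (\<Sum>c\<in>UNIV. \<Sum>e\<in>UNIV. of_bool (c = e) * weight ori (ctx1 x y c e))"
proof -
  have "closed_sum (strands (x @ y)) = (\<Sum>c\<in>UNIV. \<Sum>e\<in>UNIV. mone c e * ctx1 x y c e)"
    unfolding strands_append closed_sum_insert_mone[of "strands x" "strands y"]
    by (rule closed_sum_ctx1)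
  thus ?thesis by (simp add: barred_weight_def mone_def UNIV_bool)
qed

lemma barred_weight_H2:
  assumes A: "A \<notin># letters (x @ y @ z)" and B: "B \<notin># letters (x @ y @ z)" "A \<noteq> B"
  shows "barred_weight ori (x @ [Some A, Some B] @ y @ [Some B, Some A] @ z) =
    (\<Sum>c\<in>UNIV. \<Sum>e\<in>UNIV. \<Sum>c'\<in>UNIV. \<Sum>e'\<in>UNIV.
       loc2 (ori A) (ori B) c e c' e' * weight ori (ctx2 x y z c e c' e'))"
proof -
  have "strands (x @ [Some A, Some B] @ y @ [Some B, Some A] @ z) =
      strands x @ Some (pass A) # Some (pass B) # strands y @ Some (pass B) # Some (pass A) # strands z"
    by (simp add: strands_def)
  hence "closed_sum (strands (x @ [Some A, Some B] @ y @ [Some B, Some A] @ z)) =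
    closed_sum (strands x @ Some (mmul (pass A) (pass B)) # strands y @
      Some (mmul (pass B) (pass A)) # strands z)"
    using closed_sum_merge[of "strands x @ Some _ # strands y"] by (simp add: closed_sum_merge)
  also have "\<dots> = (\<Sum>c\<in>UNIV. \<Sum>e\<in>UNIV. \<Sum>c'\<in>UNIV. \<Sum>e'\<in>UNIV. \<Sum>d'\<in>UNIV. \<Sum>d\<in>UNIV.
      pass A c d * (pass A d' e' * (pass B d e * (pass B c' d' * ctx2 x y z c e c' e'))))"
    unfolding closed_sum_ctx2 mmul_def sum_distrib_left sum_distrib_right
    by (intro sum.cong refl) (simp add: ac_simps)
  finally show ?thesis
    by (simp only: barred_weight_def weight_sum weight_two_letters[OF graded_ctx2 A B] loc2_def
        sum_distrib_right)
qed

lemma barred_weight_H2':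
  "barred_weight ori (x @ y @ z) = (\<Sum>c\<in>UNIV. \<Sum>e\<in>UNIV. \<Sum>c'\<in>UNIV. \<Sum>e'\<in>UNIV.
     of_bool (c = e \<and> c' = e') * weight ori (ctx2 x y z c e c' e'))"
proof -
  have "closed_sum (strands (x @ y @ z)) =
     closed_sum (strands x @ Some mone # strands y @ Some mone # strands z)"
    using closed_sum_insert_mone[of "strands x" "strands y @ strands z"]
      closed_sum_insert_mone[of "strands x @ Some mone # strands y" "strands z"]
    by (simp add: strands_append)
  also have "\<dots> = (\<Sum>c\<in>UNIV. \<Sum>e\<in>UNIV. \<Sum>c'\<in>UNIV. \<Sum>e'\<in>UNIV.
     mone c e * (mone c' e' * ctx2 x y z c e c' e'))"
    by (rule closed_sum_ctx2)
  finally show ?thesis by (simp add: barred_weight_def mone_def UNIV_bool)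
qed

lemma barred_weight_H3_left:
  assumes L: "A \<notin># letters (x @ y @ z @ t)" "B \<notin># letters (x @ y @ z @ t)" "C \<notin># letters (x @ y @ z @ t)"
    and d: "A \<noteq> B" "A \<noteq> C" "B \<noteq> C"
  shows "barred_weight ori (x @ [Some A, Some B] @ y @ [Some A, Some C] @ z @ [Some B, Some C] @ t) =
    (\<Sum>c\<in>UNIV. \<Sum>e\<in>UNIV. \<Sum>c'\<in>UNIV. \<Sum>e'\<in>UNIV. \<Sum>c''\<in>UNIV. \<Sum>e''\<in>UNIV.
       loc3_left (ori A) (ori B) (ori C) c e c' e' c'' e'' * weight ori (ctx3 x y z t c e c' e' c'' e''))"
proof -
  have "strands (x @ [Some A, Some B] @ y @ [Some A, Some C] @ z @ [Some B, Some C] @ t) =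
      strands x @ Some (pass A) # Some (pass B) # strands y @ Some (pass A) # Some (pass C) # strands z @
      Some (pass B) # Some (pass C) # strands t"
    by (simp add: strands_def)
  hence "closed_sum (strands (x @ [Some A, Some B] @ y @ [Some A, Some C] @ z @ [Some B, Some C] @ t)) =
    closed_sum (strands x @ Some (mmul (pass A) (pass B)) # strands y @
      Some (mmul (pass A) (pass C)) # strands z @ Some (mmul (pass B) (pass C)) # strands t)"
    using closed_sum_merge[of "strands x @ Some _ # strands y"]
      closed_sum_merge[of "strands x @ Some _ # strands y @ Some _ # strands z"]
    by (simp add: closed_sum_merge)
  also have "\<dots> = (\<Sum>c\<in>UNIV. \<Sum>e\<in>UNIV. \<Sum>c'\<in>UNIV. \<Sum>e'\<in>UNIV. \<Sum>c''\<in>UNIV. \<Sum>e''\<in>UNIV.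
      \<Sum>d''\<in>UNIV. \<Sum>d'\<in>UNIV. \<Sum>d\<in>UNIV.
      pass A c d * (pass A c' d' * (pass B d e * (pass B c'' d'' * (pass C d' e' * (pass C d'' e'' *
        ctx3 x y z t c e c' e' c'' e''))))))"
    unfolding closed_sum_ctx3 mmul_def sum_distrib_left sum_distrib_right
    by (intro sum.cong refl) (simp add: ac_simps)
  finally show ?thesis
    by (simp only: barred_weight_def weight_sum weight_three_letters[OF graded_ctx3 L d] loc3_left_def
        sum_distrib_right)
qed

lemma barred_weight_H3_right:
  assumes L: "A \<notin># letters (x @ y @ z @ t)" "B \<notin># letters (x @ y @ z @ t)" "C \<notin># letters (x @ y @ z @ t)"
    and d: "A \<noteq> B" "A \<noteq> C" "B \<noteq> C"
  shows "barred_weight ori (x @ [Some B, Some A] @ y @ [Some C, Some A] @ z @ [Some C, Some B] @ t) =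
    (\<Sum>c\<in>UNIV. \<Sum>e\<in>UNIV. \<Sum>c'\<in>UNIV. \<Sum>e'\<in>UNIV. \<Sum>c''\<in>UNIV. \<Sum>e''\<in>UNIV.
       loc3_right (ori A) (ori B) (ori C) c e c' e' c'' e'' * weight ori (ctx3 x y z t c e c' e' c'' e''))"
proof -
  have "strands (x @ [Some B, Some A] @ y @ [Some C, Some A] @ z @ [Some C, Some B] @ t) =
      strands x @ Some (pass B) # Some (pass A) # strands y @ Some (pass C) # Some (pass A) # strands z @
      Some (pass C) # Some (pass B) # strands t"
    by (simp add: strands_def)
  hence "closed_sum (strands (x @ [Some B, Some A] @ y @ [Some C, Some A] @ z @ [Some C, Some B] @ t)) =
    closed_sum (strands x @ Some (mmul (pass B) (pass A)) # strands y @
      Some (mmul (pass C) (pass A)) # strands z @ Some (mmul (pass C) (pass B)) # strands t)"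
    using closed_sum_merge[of "strands x @ Some _ # strands y"]
      closed_sum_merge[of "strands x @ Some _ # strands y @ Some _ # strands z"]
    by (simp add: closed_sum_merge)
  also have "\<dots> = (\<Sum>c\<in>UNIV. \<Sum>e\<in>UNIV. \<Sum>c'\<in>UNIV. \<Sum>e'\<in>UNIV. \<Sum>c''\<in>UNIV. \<Sum>e''\<in>UNIV.
      \<Sum>d''\<in>UNIV. \<Sum>d'\<in>UNIV. \<Sum>d\<in>UNIV.
      pass A d e * (pass A d' e' * (pass B c d * (pass B d'' e'' * (pass C c' d' * (pass C c'' d'' *
        ctx3 x y z t c e c' e' c'' e''))))))"
    unfolding closed_sum_ctx3 mmul_def sum_distrib_left sum_distrib_right
    by (intro sum.cong refl) (simp add: ac_simps)
  finally show ?thesis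
    by (simp only: barred_weight_def weight_sum weight_three_letters[OF graded_ctx3 L d] loc3_right_def
        sum_distrib_right)
qed

lemma sum_bool: "(\<Sum>b\<in>UNIV. f b) = f False + f True" for f :: "bool \<Rightarrow> nat"
  by (simp add: UNIV_bool)

text \<open>For each way of reconnecting the letters of a move, the local contribution describes how the
  ends of the strands become joined; the tables say which of these patterns coincide. A factor \<open>2\<close> is an additional closed curve.\<close>

lemma loc1_table:
  "loc1 True c e = 2 * of_bool (c = e)"
  "loc1 False c e = of_bool (c = e)"
  by (cases c; cases e; simp add: loc1_def paired_def UNIV_bool)+

lemma loc2_table:
  "loc2 False True c e c' e' = loc2 True False c e c' e'"
  "loc2 True True c e c' e' = 2 * loc2 True False c e c' e'"
  "loc2 False False c e c' e' = of_bool (c = e \<and> c' = e')"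
  by (cases c; cases e; cases c'; cases e'; simp add: loc2_def paired_def UNIV_bool)+

lemma loc3_table:
  "loc3_left False True True c e c' e' c'' e'' = loc3_left True True False c e c' e' c'' e''"
  "loc3_left False False False c e c' e' c'' e'' = loc3_left True True False c e c' e' c'' e''"
  "loc3_left False True False c e c' e' c'' e'' = 2 * loc3_left True True False c e c' e' c'' e''"
  "loc3_right True False True c e c' e' c'' e'' = loc3_left True True False c e c' e' c'' e''"
  "loc3_right True True False c e c' e' c'' e'' = loc3_left True False True c e c' e' c'' e''"
  "loc3_right False True True c e c' e' c'' e'' = loc3_left True False True c e c' e' c'' e''"
  "loc3_right False False False c e c' e' c'' e'' = loc3_left True False True c e c' e' c'' e''"
  "loc3_right False True False c e c' e' c'' e'' = 2 * loc3_left True False True c e c' e' c'' e''"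
  "loc3_right True True True c e c' e' c'' e'' = loc3_left True True True c e c' e' c'' e''"
  "loc3_right True False False c e c' e' c'' e'' = loc3_left True False False c e c' e' c'' e''"
  "loc3_right False False True c e c' e' c'' e'' = loc3_left False False True c e c' e' c'' e''"
  unfolding loc3_left_def loc3_right_def paired_def sum_bool fst_conv snd_conv prod.inject if_True if_False
  by (cases c; cases e; cases c'; cases e'; cases c''; cases e''; simp)+


section \<open>Invariance of the Jones polynomial\<close>

lemma t_pow_mult: "t_pow a * t_pow b = t_pow (a + b)"
  by (simp add: t_pow_def mult_single)

lemma t_pow_0 [simp]: "t_pow 0 = 1"
  by (simp add: t_pow_def)

lemma neg_one_power_nat_abs_add: "(- 1 :: laurent) ^ nat \<bar>a + b\<bar> = (- 1) ^ nat \<bar>a\<bar> * (- 1) ^ nat \<bar>b\<bar>"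
proof -
  have "even (nat \<bar>a + b\<bar>) \<longleftrightarrow> even (nat \<bar>a\<bar> + nat \<bar>b\<bar>)"
    by (simp add: even_nat_iff)
  thus ?thesis by (simp add: minus_one_power_iff flip: power_add)
qed

lemma neg_t_pow_add: "neg_t_pow (a + b) = neg_t_pow a * neg_t_pow b"
  by (simp add: neg_t_pow_def neg_one_power_nat_abs_add t_pow_mult[symmetric] ac_simps)

definition loop_value :: laurent where
  "loop_value = - t_pow 2 - t_pow (- 2)"

text \<open>The summand of a state in the Jones polynomial, with \<open>\<sigma>(s)\<close> written as the sum of the markers:
  in this form the markers of the letters taking part in a move split off.\<close>

definition state_term :: "('l, int) phrase \<Rightarrow> ('l \<Rightarrow> int) \<Rightarrow> laurent" where
  "state_term P s = t_pow (\<Sum>A\<in>alph P. s A) * loop_value ^ (state_size P s - 1)"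

lemma state_sigma_eq_sum:
  assumes "finite (alph P)" "s \<in> states P"
  shows "state_sigma P s = (\<Sum>A\<in>alph P. s A)"
proof -
  have s: "s A = 1 \<or> s A = - 1" if "A \<in> alph P" for A
    using assms(2) that unfolding states_def by blast
  have "(\<Sum>A\<in>alph P. s A) = (\<Sum>A\<in>alph P. of_bool (s A = 1) - of_bool (s A = - 1))"
    using s by (intro sum.cong) fastforce+
  also have "\<dots> = state_sigma P s"
    using assms(1) by (simp add: sum_subtractf state_sigma_def Collect_conj_eq Int_commute)
  finally show ?thesis by simp
qed

lemma jones_state_terms:
  assumes "finite (alph P)"
  shows "jones P = neg_t_pow (- 3 * writhe P) * (\<Sum>s\<in>states P. state_term P s)"
  unfolding jones_def state_term_def loop_value_def by (simp add: state_sigma_eq_sum[OF assms])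

text \<open>The two markers of a letter are listed relative to its sign \<open>x\<close>, since it is the comparison
  with the sign that determines the reconnection.\<close>

lemma sum_states_insert:
  fixes f :: "('l \<Rightarrow> int) \<Rightarrow> 'r::comm_monoid_add"
  assumes "finite R" "A \<notin> R" "x = 1 \<or> x = - 1"
  shows "(\<Sum>s\<in>insert A R \<rightarrow>\<^sub>E {- 1, 1}. f s) =
         (\<Sum>s\<in>R \<rightarrow>\<^sub>E {- 1, 1}. f (s(A := x)) + f (s(A := - x)))"
proof -
  have "(\<Sum>s\<in>insert A R \<rightarrow>\<^sub>E {- 1, 1}. f s) =
      (\<Sum>(y, s)\<in>{- 1, 1} \<times> (R \<rightarrow>\<^sub>E {- 1, 1}). f (s(A := y)))"
    unfolding PiE_insert_eq using inj_combinator[OF assms(2), of "\<lambda>_. {- 1, 1 :: int}"]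
    by (subst sum.reindex) (auto simp: comp_def case_prod_unfold)
  also have "\<dots> = (\<Sum>y\<in>{- 1, 1}. \<Sum>s\<in>R \<rightarrow>\<^sub>E {- 1, 1}. f (s(A := y)))"
    by (simp add: sum.cartesian_product)
  also have "\<dots> = (\<Sum>s\<in>R \<rightarrow>\<^sub>E {- 1, 1}. f (s(A := x)) + f (s(A := - x)))"
    using assms(3) by (auto simp: sum.distrib add.commute)
  finally show ?thesis .
qed

lemma nanophrase_letters:
  assumes "nanophrase \<alpha> (Phrase \<A> p ws)" "A \<in># letters (barred ws)"
  shows "A \<in> \<A>" "p A \<in> \<alpha>" "count (letters (barred ws)) A = 2"
proof -
  have A: "A \<in> set (concat ws)"
    using assms(2) unfolding letters_barred by (simp only: set_mset_mset)
  thus "A \<in> \<A>" using assms(1) unfolding nanophrase_def phrase.sel by blast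
  thus "p A \<in> \<alpha>" "count (letters (barred ws)) A = 2"
    using assms(1) unfolding nanophrase_def phrase.sel letters_barred count_mset by blast+
qed

lemma state_size_barred_weight:
  assumes "nanophrase {-1, 1} (Phrase \<A> p ws)" "s \<in> \<A> \<rightarrow>\<^sub>E {- 1, 1}"
  shows "2 ^ state_size (Phrase \<A> p ws) s = barred_weight (\<lambda>A. s A = p A) (barred ws)"
    and "state_size (Phrase \<A> p ws) s > 0"
proof -
  have "ws \<noteq> []" using assms(1) by (simp add: nanophrase_def)
  with state_size_colourings[OF assms(1)] assms(2)
  show "2 ^ state_size (Phrase \<A> p ws) s = barred_weight (\<lambda>A. s A = p A) (barred ws)"
    "state_size (Phrase \<A> p ws) s > 0"
    by (simp_all add: states_def barred_weight)
qed

lemma two_power_eq: "(2::nat) ^ m = 2 ^ n \<Longrightarrow> m = n"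
  by simp

lemma two_power_double:
  fixes q :: laurent
  assumes "(2::nat) ^ m = 2 * 2 ^ n" "n > 0"
  shows "q ^ (m - 1) = q * q ^ (n - 1)"
proof -
  have "(2::nat) ^ m = 2 ^ Suc n" using assms(1) by simp
  hence "m = Suc n" by (rule two_power_eq)
  thus ?thesis using assms(2) by (cases n) auto
qed

text \<open>The circle split off when the marker is the sign of the letter contributes the loop value, and
  \<open>t ^ \<epsilon> * loop_value + t ^ (- \<epsilon>) = - t ^ (3 \<epsilon>)\<close>.\<close>

lemma jones_H1:
  assumes P: "nanophrase {-1, 1} (Phrase \<A> p ws)" and P': "nanophrase {-1, 1} (Phrase (\<A> - {A}) p ws')"
    and ws: "barred ws = x @ [Some A, Some A] @ y" and ws': "barred ws' = x @ y"
  shows "jones (Phrase \<A> p ws) = jones (Phrase (\<A> - {A}) p ws')"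
proof -
  let ?P = "Phrase \<A> p ws" and ?P' = "Phrase (\<A> - {A}) p ws'"
  let ?R = "\<A> - {A}"
  have fin: "finite \<A>" using P by (simp add: nanophrase_def)
  note A' = nanophrase_letters[OF P, of A, unfolded ws]
  have A: "A \<in> \<A>" and pA: "p A = 1 \<or> p A = - 1" and notin: "A \<notin># letters (x @ y)"
    using A' by (auto simp flip: count_eq_zero_iff)
  have \<A>: "\<A> = insert A ?R" using A by blast
  have terms: "state_term ?P (s(A := p A)) + state_term ?P (s(A := - p A)) =
      - t_pow (3 * p A) * state_term ?P' s" if s: "s \<in> ?R \<rightarrow>\<^sub>E {- 1, 1}" for s
  proof -
    define ori where "ori = (\<lambda>B. s B = p B)"
    define n' where "n' = state_size ?P' s"
    have n': "2 ^ n' = (\<Sum>c\<in>UNIV. \<Sum>e\<in>UNIV. of_bool (c = e) * weight ori (ctx1 x y c e))" "n' > 0"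
      using state_size_barred_weight[OF P' s] by (simp_all only: n'_def ws' barred_weight_H1' ori_def)
    have n: "2 ^ state_size ?P (s(A := z)) =
        (\<Sum>c\<in>UNIV. \<Sum>e\<in>UNIV. loc1 (z = p A) c e * weight ori (ctx1 x y c e))"
      if "z = p A \<or> z = - p A" for z
    proof -
      have "s(A := z) \<in> \<A> \<rightarrow>\<^sub>E {- 1, 1}"
        using s pA that A by (auto simp: PiE_iff extensional_def)
      from state_size_barred_weight(1)[OF P this]
      have "2 ^ state_size ?P (s(A := z)) = barred_weight (\<lambda>B. (s(A := z)) B = p B) (barred ws)" .
      also have "weight (\<lambda>B. (s(A := z)) B = p B) (ctx1 x y c e) = weight ori (ctx1 x y c e)" for c e
        by (rule weight_cong[OF graded_ctx1]) (use notin in \<open>auto simp: ori_def\<close>)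
      hence "barred_weight (\<lambda>B. (s(A := z)) B = p B) (barred ws) =
          (\<Sum>c\<in>UNIV. \<Sum>e\<in>UNIV. loc1 (z = p A) c e * weight ori (ctx1 x y c e))"
        unfolding ws barred_weight_H1[OF notin] by simp
      finally show ?thesis .
    qed
    have "2 ^ state_size ?P (s(A := p A)) = 2 * (2::nat) ^ n'"
      using n[of "p A"] unfolding n'(1) by (simp only: simp_thms loc1_table sum_distrib_left mult.assoc)
    note pos = two_power_double[OF this n'(2)]
    have "2 ^ state_size ?P (s(A := - p A)) = (2::nat) ^ n'"
      using n[of "- p A"] n'(1) pA by (auto simp: loc1_table)
    note neg = two_power_eq[OF this]
    have "(\<Sum>B\<in>\<A>. (s(A := z)) B) = z + (\<Sum>B\<in>?R. s B)" for z
      using fin A by (subst sum.remove[of _ A]) (auto intro: sum.cong)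
    hence st: "state_term ?P (s(A := z)) = t_pow z * (t_pow (\<Sum>B\<in>?R. s B) *
        loop_value ^ (state_size ?P (s(A := z)) - 1))" for z
      unfolding state_term_def phrase.sel by (simp only: t_pow_mult[symmetric] mult.assoc)
    have st': "state_term ?P' s = t_pow (\<Sum>B\<in>?R. s B) * loop_value ^ (n' - 1)"
      by (simp add: state_term_def n'_def)
    have coeff: "t_pow (p A) * loop_value + t_pow (- p A) = - t_pow (3 * p A)"
      using pA by (auto simp: loop_value_def right_diff_distrib t_pow_mult)
    have "state_term ?P (s(A := p A)) + state_term ?P (s(A := - p A)) =
        (t_pow (p A) * loop_value + t_pow (- p A)) * state_term ?P' s"
      unfolding st st' pos neg by (simp add: algebra_simps)
    thus ?thesis by (simp only: coeff)
  qed
  have "(\<Sum>s\<in>states ?P. state_term ?P s) = (\<Sum>s\<in>?R \<rightarrow>\<^sub>E {- 1, 1}. - t_pow (3 * p A) * state_term ?P' s)"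
    using sum_states_insert[of ?R A "p A" "state_term ?P"] fin pA terms \<A> by (simp add: states_def)
  also have "\<dots> = - t_pow (3 * p A) * (\<Sum>s\<in>states ?P'. state_term ?P' s)"
    by (simp add: states_def sum_distrib_left)
  finally have sums: "(\<Sum>s\<in>states ?P. state_term ?P s) =
      - t_pow (3 * p A) * (\<Sum>s\<in>states ?P'. state_term ?P' s)" .
  have "writhe ?P = p A + writhe ?P'"
    using fin A by (simp add: writhe_def sum.remove)
  hence w: "neg_t_pow (- 3 * writhe ?P) = neg_t_pow (- 3 * p A) * neg_t_pow (- 3 * writhe ?P')"
    by (simp add: neg_t_pow_add[symmetric] algebra_simps)
  have unit: "neg_t_pow (- 3 * p A) * - t_pow (3 * p A) = 1"
    using pA by (auto simp: neg_t_pow_def t_pow_mult)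
  have finP: "finite (alph ?P)" "finite (alph ?P')" using fin by simp_all
  have "jones ?P = (neg_t_pow (- 3 * p A) * - t_pow (3 * p A)) *
      (neg_t_pow (- 3 * writhe ?P') * (\<Sum>s\<in>states ?P'. state_term ?P' s))"
    unfolding jones_state_terms[OF finP(1)] sums w by (simp only: mult_ac)
  thus ?thesis
    by (simp only: unit jones_state_terms[OF finP(2)] mult_1)
qed

text \<open>Only the state in which both markers are opposite to the signs is seen by the phrase without the
  two letters. The other three cancel, which is the reason for the choice of the loop value.\<close>

lemma jones_H2:
  assumes P: "nanophrase {-1, 1} (Phrase \<A> p ws)" and P': "nanophrase {-1, 1} (Phrase (\<A> - {A, B}) p ws')"
    and ws: "barred ws = x @ [Some A, Some B] @ y @ [Some B, Some A] @ z" and ws': "barred ws' = x @ y @ z"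
    and opposite: "p B = - p A"
  shows "jones (Phrase \<A> p ws) = jones (Phrase (\<A> - {A, B}) p ws')"
proof -
  let ?P = "Phrase \<A> p ws" and ?P' = "Phrase (\<A> - {A, B}) p ws'"
  let ?R = "\<A> - {A, B}"
  have fin: "finite \<A>" using P by (simp add: nanophrase_def)
  note A' = nanophrase_letters[OF P, of A, unfolded ws] and B' = nanophrase_letters[OF P, of B, unfolded ws]
  have AB: "A \<noteq> B" using A'(3) by auto
  have A: "A \<in> \<A>" and pA: "p A = 1 \<or> p A = - 1" and A_notin: "A \<notin># letters (x @ y @ z)"
    using A' AB by (auto simp flip: count_eq_zero_iff)
  have B: "B \<in> \<A>" and pB: "p B = 1 \<or> p B = - 1" and B_notin: "B \<notin># letters (x @ y @ z)"
    using B' AB by (auto simp flip: count_eq_zero_iff)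
  have \<A>: "\<A> = insert A (insert B ?R)" using A B by blast
  have terms: "state_term ?P (s(B := p B, A := p A)) + state_term ?P (s(B := p B, A := - p A)) +
      (state_term ?P (s(B := - p B, A := p A)) + state_term ?P (s(B := - p B, A := - p A))) =
      state_term ?P' s" if s: "s \<in> ?R \<rightarrow>\<^sub>E {- 1, 1}" for s
  proof -
    define ori where "ori = (\<lambda>X. s X = p X)"
    define n' where "n' = state_size ?P' s"
    define n where "n a b = state_size ?P (s(B := b, A := a))" for a b
    have n': "2 ^ n' = (\<Sum>c\<in>UNIV. \<Sum>e\<in>UNIV. \<Sum>c'\<in>UNIV. \<Sum>e'\<in>UNIV.
        of_bool (c = e \<and> c' = e') * weight ori (ctx2 x y z c e c' e'))"
      using state_size_barred_weight(1)[OF P' s] by (simp only: n'_def ws' barred_weight_H2' ori_def)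
    have n: "2 ^ n a b = (\<Sum>c\<in>UNIV. \<Sum>e\<in>UNIV. \<Sum>c'\<in>UNIV. \<Sum>e'\<in>UNIV.
        loc2 (a = p A) (b = p B) c e c' e' * weight ori (ctx2 x y z c e c' e'))" and n_pos: "n a b > 0"
      if "a = p A \<or> a = - p A" "b = p B \<or> b = - p B" for a b
    proof -
      let ?s = "s(B := b, A := a)"
      have s': "?s \<in> \<A> \<rightarrow>\<^sub>E {- 1, 1}"
        using s pA pB that A B by (auto simp: PiE_iff extensional_def)
      from state_size_barred_weight(2)[OF P s'] show "n a b > 0" by (simp only: n_def)
      from state_size_barred_weight(1)[OF P s']
      have "2 ^ n a b = barred_weight (\<lambda>X. ?s X = p X) (barred ws)" by (simp only: n_def)
      also have "weight (\<lambda>X. ?s X = p X) (ctx2 x y z c e c' e') = weight ori (ctx2 x y z c e c' e')" for c e c' e'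
        by (rule weight_cong[OF graded_ctx2]) (use A_notin B_notin in \<open>auto simp: ori_def\<close>)
      hence "barred_weight (\<lambda>X. ?s X = p X) (barred ws) =
          (\<Sum>c\<in>UNIV. \<Sum>e\<in>UNIV. \<Sum>c'\<in>UNIV. \<Sum>e'\<in>UNIV.
             loc2 (a = p A) (b = p B) c e c' e' * weight ori (ctx2 x y z c e c' e'))"
        unfolding ws barred_weight_H2[OF A_notin B_notin AB] using AB by simp
      finally show "2 ^ n a b = \<dots>" .
    qed
    have neq: "(- p A = p A) = False" "(- p B = p B) = False" using pA pB by auto
    have "2 ^ n (p A) (p B) = 2 * (2::nat) ^ n (p A) (- p B)"
      unfolding n[OF disjI1[OF refl] disjI1[OF refl]] n[OF disjI1[OF refl] disjI2[OF refl]]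
      by (simp only: neq simp_thms loc2_table sum_distrib_left mult.assoc)
    note same = two_power_double[OF this n_pos[OF disjI1[OF refl] disjI2[OF refl]]]
    have "2 ^ n (- p A) (p B) = (2::nat) ^ n (p A) (- p B)"
      unfolding n[OF disjI2[OF refl] disjI1[OF refl]] n[OF disjI1[OF refl] disjI2[OF refl]]
      by (simp only: neq simp_thms loc2_table)
    note mixed = two_power_eq[OF this]
    have "2 ^ n (- p A) (- p B) = (2::nat) ^ n'"
      unfolding n[OF disjI2[OF refl] disjI2[OF refl]] n'
      by (simp only: neq simp_thms loc2_table)
    note twisted = two_power_eq[OF this]
    have "(\<Sum>X\<in>\<A>. (s(B := b, A := a)) X) = a + (b + (\<Sum>X\<in>?R. s X))" for a b
      using fin A B AB by (subst \<A>) (auto intro!: sum.cong)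
    hence st: "state_term ?P (s(B := b, A := a)) = t_pow a * (t_pow b * (t_pow (\<Sum>X\<in>?R. s X) *
        loop_value ^ (n a b - 1)))" for a b
      unfolding state_term_def phrase.sel n_def by (simp only: t_pow_mult[symmetric] mult.assoc)
    have st': "state_term ?P' s = t_pow (\<Sum>X\<in>?R. s X) * loop_value ^ (n' - 1)"
      by (simp add: state_term_def n'_def)
    have coeff: "t_pow (p A) * t_pow (p B) * loop_value + t_pow (- p A) * t_pow (p B) +
        t_pow (p A) * t_pow (- p B) = 0" "t_pow (- p A) * t_pow (- p B) = 1"
      using pA opposite by (auto simp: loop_value_def right_diff_distrib t_pow_mult)
    have "state_term ?P (s(B := p B, A := p A)) + state_term ?P (s(B := p B, A := - p A)) +
      (state_term ?P (s(B := - p B, A := p A)) + state_term ?P (s(B := - p B, A := - p A))) =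
      (t_pow (p A) * t_pow (p B) * loop_value + t_pow (- p A) * t_pow (p B) +
        t_pow (p A) * t_pow (- p B)) * (t_pow (\<Sum>X\<in>?R. s X) * loop_value ^ (n (p A) (- p B) - 1)) +
      t_pow (- p A) * t_pow (- p B) * state_term ?P' s"
      unfolding st st' same mixed twisted by (simp add: algebra_simps)
    thus ?thesis by (simp only: coeff mult_zero_left mult_1 add_0)
  qed
  have "(\<Sum>s\<in>states ?P. state_term ?P s) =
      (\<Sum>s\<in>insert B ?R \<rightarrow>\<^sub>E {- 1, 1}. state_term ?P (s(A := p A)) + state_term ?P (s(A := - p A)))"
    using sum_states_insert[of "insert B ?R" A "p A" "state_term ?P"] fin pA AB \<A> by (simp add: states_def)
  also have "\<dots> = (\<Sum>s\<in>?R \<rightarrow>\<^sub>E {- 1, 1}. state_term ?P' s)"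
    using fin pB by (subst sum_states_insert[of ?R B "p B"]) (auto intro!: sum.cong simp: terms)
  finally have sums: "(\<Sum>s\<in>states ?P. state_term ?P s) = (\<Sum>s\<in>states ?P'. state_term ?P' s)"
    by (simp add: states_def)
  have "writhe ?P = p A + (p B + writhe ?P')"
    using fin A B AB unfolding writhe_def phrase.sel by (subst \<A>) simp
  hence w: "writhe ?P = writhe ?P'" using opposite by simp
  have finP: "finite (alph ?P)" "finite (alph ?P')" using fin by simp_all
  show ?thesis
    unfolding jones_state_terms[OF finP(1)] jones_state_terms[OF finP(2)] sums w ..
qed

text \<open>On the left are the coefficients of the four states that share a curve pattern (one of them with
  an additional circle), on the right the coefficient of the single state that shows this pattern on
  the other side of the move.\<close>

lemma third_move_coefficients:
  assumes "(a, b, c) \<in> S_sharp {- 1, 1} uminus id"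
  shows "t_pow a * t_pow b * t_pow (- c) + t_pow (- a) * t_pow b * t_pow c +
      t_pow (- a) * t_pow b * t_pow (- c) * loop_value + t_pow (- a) * t_pow (- b) * t_pow (- c) =
      t_pow a * t_pow (- b) * t_pow c"
  using assms by (auto simp: S_sharp_def loop_value_def right_diff_distrib t_pow_mult)

text \<open>Let \<open>Y\<close> be the contribution, without the markers of the three letters, of the curve pattern common
  to four of the eight states on the left, and \<open>Z\<close> that of the pattern common to four states on the
  right. Left and right are then \<open>v * Y + u * Z\<close> and \<open>u * Y + v * Z\<close>, up to equal terms, with
  \<open>u = v\<close>.\<close>

lemma jones_H3:
  assumes P: "nanophrase {-1, 1} (Phrase \<A> p ws)" and P': "nanophrase {-1, 1} (Phrase \<A> p ws')"
    and ws: "barred ws = x @ [Some A, Some B] @ y @ [Some A, Some C] @ z @ [Some B, Some C] @ t"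
    and ws': "barred ws' = x @ [Some B, Some A] @ y @ [Some C, Some A] @ z @ [Some C, Some B] @ t"
    and S: "(p A, p B, p C) \<in> S_sharp {- 1, 1} uminus id"
  shows "jones (Phrase \<A> p ws) = jones (Phrase \<A> p ws')"
proof -
  let ?P = "Phrase \<A> p ws" and ?P' = "Phrase \<A> p ws'"
  let ?R = "\<A> - {A, B, C}"
  have fin: "finite \<A>" using P by (simp add: nanophrase_def)
  note A' = nanophrase_letters[OF P, of A, unfolded ws] and B' = nanophrase_letters[OF P, of B, unfolded ws]
    and C' = nanophrase_letters[OF P, of C, unfolded ws]
  have AB: "A \<noteq> B" using A'(3) by auto
  have AC: "A \<noteq> C" using A'(3) AB by (cases "B = C") auto
  have BC: "B \<noteq> C" using B'(3) AB by (cases "A = C") auto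
  have A: "A \<in> \<A>" and pA: "p A = 1 \<or> p A = - 1" and A_notin: "A \<notin># letters (x @ y @ z @ t)"
    using A' AB AC by (auto simp flip: count_eq_zero_iff)
  have B: "B \<in> \<A>" and pB: "p B = 1 \<or> p B = - 1" and B_notin: "B \<notin># letters (x @ y @ z @ t)"
    using B' AB BC by (auto simp flip: count_eq_zero_iff)
  have C: "C \<in> \<A>" and pC: "p C = 1 \<or> p C = - 1" and C_notin: "C \<notin># letters (x @ y @ z @ t)"
    using C' AC BC by (auto simp flip: count_eq_zero_iff)
  have \<A>: "\<A> = insert A (insert B (insert C ?R))" using A B C by blast
  define eight where "eight Q s =
      state_term Q (s(C := p C, B := p B, A := p A)) + state_term Q (s(C := p C, B := p B, A := - p A)) +
      (state_term Q (s(C := p C, B := - p B, A := p A)) + state_term Q (s(C := p C, B := - p B, A := - p A))) +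
      (state_term Q (s(C := - p C, B := p B, A := p A)) + state_term Q (s(C := - p C, B := p B, A := - p A)) +
      (state_term Q (s(C := - p C, B := - p B, A := p A)) + state_term Q (s(C := - p C, B := - p B, A := - p A))))"
    for Q :: "('a, int) phrase" and s
  have terms: "eight ?P s = eight ?P' s" if s: "s \<in> ?R \<rightarrow>\<^sub>E {- 1, 1}" for s
  proof -
    define ori where "ori = (\<lambda>X. s X = p X)"
    define n where "n a b c = state_size ?P (s(C := c, B := b, A := a))" for a b c
    define n' where "n' a b c = state_size ?P' (s(C := c, B := b, A := a))" for a b c
    have n: "2 ^ n a b c = (\<Sum>k\<in>UNIV. \<Sum>e\<in>UNIV. \<Sum>k'\<in>UNIV. \<Sum>e'\<in>UNIV. \<Sum>k''\<in>UNIV. \<Sum>e''\<in>UNIV.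
        loc3_left (a = p A) (b = p B) (c = p C) k e k' e' k'' e'' *
        weight ori (ctx3 x y z t k e k' e' k'' e''))" (is "_ = ?left a b c")
      and n': "2 ^ n' a b c = (\<Sum>k\<in>UNIV. \<Sum>e\<in>UNIV. \<Sum>k'\<in>UNIV. \<Sum>e'\<in>UNIV. \<Sum>k''\<in>UNIV. \<Sum>e''\<in>UNIV.
        loc3_right (a = p A) (b = p B) (c = p C) k e k' e' k'' e'' *
        weight ori (ctx3 x y z t k e k' e' k'' e''))" (is "_ = ?right a b c")
      and n_pos: "n a b c > 0"
      if "a = p A \<or> a = - p A" "b = p B \<or> b = - p B" "c = p C \<or> c = - p C" for a b c
    proof -
      let ?s = "s(C := c, B := b, A := a)"
      have s': "?s \<in> \<A> \<rightarrow>\<^sub>E {- 1, 1}"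
        using s pA pB pC that A B C by (auto simp: PiE_iff extensional_def)
      from state_size_barred_weight(2)[OF P s'] show "n a b c > 0" by (simp only: n_def)
      have w: "weight (\<lambda>X. ?s X = p X) (ctx3 x y z t k e k' e' k'' e'') =
          weight ori (ctx3 x y z t k e k' e' k'' e'')" for k e k' e' k'' e''
        by (rule weight_cong[OF graded_ctx3]) (use A_notin B_notin C_notin in \<open>auto simp: ori_def\<close>)
      have s_eq: "(?s A = p A) = (a = p A)" "(?s B = p B) = (b = p B)" "(?s C = p C) = (c = p C)"
        using AB AC BC by simp_all
      from state_size_barred_weight(1)[OF P s'] show "2 ^ n a b c = ?left a b c"
        unfolding ws barred_weight_H3_left[OF A_notin B_notin C_notin AB AC BC] w s_eq n_def .
      from state_size_barred_weight(1)[OF P' s'] show "2 ^ n' a b c = ?right a b c"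
        unfolding ws' barred_weight_H3_right[OF A_notin B_notin C_notin AB AC BC] w s_eq n_def n'_def .
    qed
    have neq: "(- p A = p A) = False" "(- p B = p B) = False" "(- p C = p C) = False"
      using pA pB pC by auto
    note pos = disjI1[OF refl] and neg = disjI2[OF refl]
    \<comment> \<open>The pattern of \<open>(p A, p B, - p C)\<close> recurs in three further states on the left (\<open>l1\<close>, \<open>l2\<close>,
      \<open>l3\<close>) and in one on the right (\<open>r1\<close>); that of \<open>(p A, - p B, p C)\<close> in four on the right (\<open>r2\<close> to
      \<open>r5\<close>). The other states on the two sides correspond (\<open>r6\<close> to \<open>r8\<close>).\<close>
    have "2 ^ n (- p A) (p B) (p C) = (2::nat) ^ n (p A) (p B) (- p C)"
      unfolding n[OF neg pos pos] n[OF pos pos neg] by (simp only: neq simp_thms loc3_table)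
    note l1 = two_power_eq[OF this]
    have "2 ^ n (- p A) (- p B) (- p C) = (2::nat) ^ n (p A) (p B) (- p C)"
      unfolding n[OF neg neg neg] n[OF pos pos neg] by (simp only: neq simp_thms loc3_table)
    note l2 = two_power_eq[OF this]
    have "2 ^ n (- p A) (p B) (- p C) = 2 * (2::nat) ^ n (p A) (p B) (- p C)"
      unfolding n[OF neg pos neg] n[OF pos pos neg]
      by (simp only: neq simp_thms loc3_table sum_distrib_left mult.assoc)
    note l3 = two_power_double[OF this n_pos[OF pos pos neg]]
    have "2 ^ n' (p A) (- p B) (p C) = (2::nat) ^ n (p A) (p B) (- p C)"
      unfolding n'[OF pos neg pos] n[OF pos pos neg] by (simp only: neq simp_thms loc3_table)
    note r1 = two_power_eq[OF this]
    have "2 ^ n' (p A) (p B) (- p C) = (2::nat) ^ n (p A) (- p B) (p C)"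
      unfolding n'[OF pos pos neg] n[OF pos neg pos] by (simp only: neq simp_thms loc3_table)
    note r2 = two_power_eq[OF this]
    have "2 ^ n' (- p A) (p B) (p C) = (2::nat) ^ n (p A) (- p B) (p C)"
      unfolding n'[OF neg pos pos] n[OF pos neg pos] by (simp only: neq simp_thms loc3_table)
    note r3 = two_power_eq[OF this]
    have "2 ^ n' (- p A) (- p B) (- p C) = (2::nat) ^ n (p A) (- p B) (p C)"
      unfolding n'[OF neg neg neg] n[OF pos neg pos] by (simp only: neq simp_thms loc3_table)
    note r4 = two_power_eq[OF this]
    have "2 ^ n' (- p A) (p B) (- p C) = 2 * (2::nat) ^ n (p A) (- p B) (p C)"
      unfolding n'[OF neg pos neg] n[OF pos neg pos]
      by (simp only: neq simp_thms loc3_table sum_distrib_left mult.assoc)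
    note r5 = two_power_double[OF this n_pos[OF pos neg pos]]
    have "2 ^ n' (p A) (p B) (p C) = (2::nat) ^ n (p A) (p B) (p C)"
      unfolding n'[OF pos pos pos] n[OF pos pos pos] by (simp only: neq simp_thms loc3_table)
    note r6 = two_power_eq[OF this]
    have "2 ^ n' (p A) (- p B) (- p C) = (2::nat) ^ n (p A) (- p B) (- p C)"
      unfolding n'[OF pos neg neg] n[OF pos neg neg] by (simp only: neq simp_thms loc3_table)
    note r7 = two_power_eq[OF this]
    have "2 ^ n' (- p A) (- p B) (p C) = (2::nat) ^ n (- p A) (- p B) (p C)"
      unfolding n'[OF neg neg pos] n[OF neg neg pos] by (simp only: neq simp_thms loc3_table)
    note r8 = two_power_eq[OF this]
    have sum: "(\<Sum>X\<in>\<A>. (s(C := c, B := b, A := a)) X) = a + (b + (c + (\<Sum>X\<in>?R. s X)))" for a b c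
      using fin A B C AB AC BC by (subst \<A>) (auto intro!: sum.cong)
    define T where "T = t_pow (\<Sum>X\<in>?R. s X)"
    have st: "state_term ?P (s(C := c, B := b, A := a)) = t_pow a * (t_pow b * (t_pow c * (T *
        loop_value ^ (n a b c - 1))))" for a b c
      unfolding state_term_def phrase.sel n_def sum T_def by (simp only: t_pow_mult[symmetric] mult.assoc)
    have st': "state_term ?P' (s(C := c, B := b, A := a)) = t_pow a * (t_pow b * (t_pow c * (T *
        loop_value ^ (n' a b c - 1))))" for a b c
      unfolding state_term_def phrase.sel n'_def sum T_def by (simp only: t_pow_mult[symmetric] mult.assoc)
    define u where "u = t_pow (p A) * t_pow (- p B) * t_pow (p C)"
    define v where "v = t_pow (p A) * t_pow (p B) * t_pow (- p C) + t_pow (- p A) * t_pow (p B) * t_pow (p C) +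
      t_pow (- p A) * t_pow (p B) * t_pow (- p C) * loop_value + t_pow (- p A) * t_pow (- p B) * t_pow (- p C)"
    define Y where "Y = T * loop_value ^ (n (p A) (p B) (- p C) - 1)"
    define Z where "Z = T * loop_value ^ (n (p A) (- p B) (p C) - 1)"
    define common where "common =
      t_pow (p A) * t_pow (p B) * t_pow (p C) * (T * loop_value ^ (n (p A) (p B) (p C) - 1)) +
      t_pow (p A) * t_pow (- p B) * t_pow (- p C) * (T * loop_value ^ (n (p A) (- p B) (- p C) - 1)) +
      t_pow (- p A) * t_pow (- p B) * t_pow (p C) * (T * loop_value ^ (n (- p A) (- p B) (p C) - 1))"
    have "eight ?P s = common + v * Y + u * Z"
      unfolding eight_def st l1 l2 l3 u_def v_def Y_def Z_def common_def by (simp add: algebra_simps)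
    moreover have "eight ?P' s = common + u * Y + v * Z"
      unfolding eight_def st' r1 r2 r3 r4 r5 r6 r7 r8 u_def v_def Y_def Z_def common_def
      by (simp add: algebra_simps)
    moreover have "u = v"
      unfolding u_def v_def using third_move_coefficients[OF S] by (rule sym)
    ultimately show ?thesis by simp
  qed
  have sums: "(\<Sum>s\<in>states Q. state_term Q s) = (\<Sum>s\<in>?R \<rightarrow>\<^sub>E {- 1, 1}. eight Q s)"
    if "alph Q = \<A>" for Q
  proof -
    have "(\<Sum>s\<in>states Q. state_term Q s) = (\<Sum>s\<in>insert B (insert C ?R) \<rightarrow>\<^sub>E {- 1, 1}.
        state_term Q (s(A := p A)) + state_term Q (s(A := - p A)))"
      using sum_states_insert[of "insert B (insert C ?R)" A "p A" "state_term Q"] fin pA AB AC \<A> that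
      by (simp add: states_def)
    also have "\<dots> = (\<Sum>s\<in>insert C ?R \<rightarrow>\<^sub>E {- 1, 1}.
        state_term Q (s(B := p B, A := p A)) + state_term Q (s(B := p B, A := - p A)) +
        (state_term Q (s(B := - p B, A := p A)) + state_term Q (s(B := - p B, A := - p A))))"
      using fin pB BC by (subst sum_states_insert[of "insert C ?R" B "p B"]) auto
    also have "\<dots> = (\<Sum>s\<in>?R \<rightarrow>\<^sub>E {- 1, 1}. eight Q s)"
      using fin pC by (subst sum_states_insert[of ?R C "p C"]) (auto simp: eight_def)
    finally show ?thesis .
  qed
  have w: "writhe ?P = writhe ?P'" by (simp add: writhe_def)
  have finP: "finite (alph ?P)" "finite (alph ?P')" using fin by simp_all
  have "(\<Sum>s\<in>states ?P. state_term ?P s) = (\<Sum>s\<in>states ?P'. state_term ?P' s)"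
    by (simp add: sums terms)
  thus ?thesis
    unfolding jones_state_terms[OF finP(1)] jones_state_terms[OF finP(2)] w by (rule arg_cong)
qed

lemma compatible_rename:
  assumes M: "image_mset letter M = L" and two: "\<And>A. A \<in># L \<Longrightarrow> count L A = 2"
    and inj: "inj_on f (set_mset L)" and ori: "\<And>A. A \<in># L \<Longrightarrow> ori' (f A) = ori A"
  shows "compatible ori' (image_mset (\<lambda>(a, A, b). (a, f A, b)) M) \<longleftrightarrow> compatible ori M"
proof -
  let ?h = "\<lambda>(a, A, b). (a, f A, b)"
  let ?f = "\<lambda>A. filter_mset (\<lambda>t. letter t = A)"
  have L: "set_mset L = letter ` set_mset M" unfolding M[symmetric] by (rule set_image_mset)
  have at: "compatible_at (ori' (f A)) (f A) (?f (f A) (image_mset ?h M)) \<longleftrightarrow>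
      compatible_at (ori A) A (?f A M)" if A: "A \<in># L" for A
  proof -
    have "?f (f A) (image_mset ?h M) = image_mset ?h (filter_mset (\<lambda>t. f (letter t) = f A) M)"
      by (simp add: filter_mset_image_mset case_prod_unfold letter_def)
    also have "filter_mset (\<lambda>t. f (letter t) = f A) M = ?f A M"
      using inj A L by (intro filter_mset_cong refl) (auto dest: inj_onD)
    finally have h: "?f (f A) (image_mset ?h M) = image_mset ?h (?f A M)" .
    obtain c d c' d' where "?f A M = {#(c, A, d), (c', A, d')#}"
      using filter_letter_2[of M A] two[OF A] M by metis
    thus ?thesis using h ori[OF A] by simp
  qed
  have "image_mset letter (image_mset ?h M) = image_mset f L"
    unfolding M[symmetric] by (simp add: image_mset.compositionality comp_def case_prod_unfold letter_def)
  hence empty: "?f B (image_mset ?h M) = {#}" if "B \<notin> f ` set_mset L" for B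
    unfolding filter_letter_empty using that by (simp only: set_image_mset not_False_eq_True)
  have empty': "?f A M = {#}" if "A \<notin># L" for A
    unfolding filter_letter_empty M by (rule that)
  show ?thesis
  proof
    assume *: "compatible ori' (image_mset ?h M)"
    show "compatible ori M"
      unfolding compatible_def
    proof
      fix A
      show "compatible_at (ori A) A (?f A M)"
      proof (cases "A \<in># L")
        case True
        have "compatible_at (ori' (f A)) (f A) (?f (f A) (image_mset ?h M))"
          using * by (simp only: compatible_def)
        thus ?thesis by (simp only: at[OF True])
      next
        case False
        show ?thesis by (simp only: empty'[OF False] compatible_at_empty)
      qed
    qed
  next
    assume *: "compatible ori M"
    show "compatible ori' (image_mset ?h M)"
      unfolding compatible_def
    proof
      fix B
      show "compatible_at (ori' B) B (?f B (image_mset ?h M))"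
      proof (cases "B \<in> f ` set_mset L")
        case True
        then obtain A where A: "B = f A" "A \<in># L" by blast
        have "compatible_at (ori A) A (?f A M)" using * by (simp add: compatible_def)
        thus ?thesis using at[OF A(2)] by (simp only: A(1))
      next
        case False
        show ?thesis by (simp only: empty[OF False] compatible_at_empty)
      qed
    qed
  qed
qed

lemma colourings_rename:
  assumes "\<And>A. A \<in> set (concat ws) \<Longrightarrow> count (mset (concat ws)) A = 2"
    and "inj_on f (set (concat ws))" and "\<And>A. A \<in> set (concat ws) \<Longrightarrow> ori' (f A) = ori A"
  shows "colourings ori' (map (map f) ws) = colourings ori ws"
  unfolding colourings_def weight_def integ_phrase_sum_map
proof (rule integ_cong)
  fix M assume "M \<in> Poly_Mapping.keys (phrase_sum ws)"
  hence "image_mset letter M = mset (concat ws)"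
    using graded_phrase_sum[of ws] by (simp only: graded_def)
  hence "compatible ori' (image_mset (\<lambda>(a, A, b). (a, f A, b)) M) \<longleftrightarrow> compatible ori M"
    by (rule compatible_rename) (use assms in \<open>simp_all only: set_mset_mset\<close>)
  thus "(of_bool (compatible ori' (image_mset (\<lambda>(a, A, b). (a, f A, b)) M)) :: nat) =
      of_bool (compatible ori M)" by simp
qed

lemma jones_isomorphic:
  assumes P: "nanophrase {-1, 1} P" and P': "nanophrase {-1, 1} P'" and "isomorphic P P'"
  shows "jones P = jones P'"
proof -
  obtain f where f: "bij_betw f (alph P) (alph P')" "\<And>A. A \<in> alph P \<Longrightarrow> proj P' (f A) = proj P A"
    "comps P' = map (map f) (comps P)"
    using assms(3) unfolding isomorphic_def by blast
  have fin: "finite (alph P)" "finite (alph P')" using P P' by (simp_all add: nanophrase_def)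
  let ?g = "inv_into (alph P) f"
  have g: "bij_betw ?g (alph P') (alph P)" using f(1) by (rule bij_betw_inv_into)
  have fg: "\<And>B. B \<in> alph P' \<Longrightarrow> f (?g B) = B" and gf: "\<And>A. A \<in> alph P \<Longrightarrow> ?g (f A) = A"
    using f(1) by (simp_all add: bij_betw_inv_into_right bij_betw_inv_into_left)
  let ?pull = "\<lambda>s. \<lambda>A\<in>alph P. s (f A)" and ?push = "\<lambda>s. \<lambda>B\<in>alph P'. s (?g B)"
  have fA: "\<And>A. A \<in> alph P \<Longrightarrow> f A \<in> alph P'" and gB: "\<And>B. B \<in> alph P' \<Longrightarrow> ?g B \<in> alph P"
    using f(1) g by (auto simp: bij_betw_def)
  have term_eq: "state_term P (?pull s) = state_term P' s" if s: "s \<in> states P'" for s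
  proof -
    have s': "?pull s \<in> states P"
      using s fA unfolding states_def by (auto simp: PiE_iff)
    have "set (concat (comps P)) \<subseteq> alph P" and two: "\<forall>A\<in>alph P. count (mset (concat (comps P))) A = 2"
      using P unfolding nanophrase_def count_mset by blast+
    hence sub: "\<And>A. A \<in> set (concat (comps P)) \<Longrightarrow> A \<in> alph P" by blast
    have "2 ^ state_size P' s = colourings (\<lambda>A. s A = proj P' A) (map (map f) (comps P))"
      using state_size_colourings(1)[OF P' s] by (simp only: f(3))
    also have "\<dots> = colourings (\<lambda>A. ?pull s A = proj P A) (comps P)"
    proof (rule colourings_rename)
      show "inj_on f (set (concat (comps P)))"
        using f(1) sub by (meson bij_betw_imp_inj_on inj_on_subset subsetI)
    qed (use sub two f(2) in \<open>simp_all only: restrict_apply simp_thms if_True\<close>)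
    also have "\<dots> = 2 ^ state_size P (?pull s)"
      using state_size_colourings(1)[OF P s'] by simp
    finally have size: "state_size P' s = state_size P (?pull s)" by (rule two_power_eq)
    have "(\<Sum>A\<in>alph P. ?pull s A) = (\<Sum>A\<in>alph P. s (f A))" by (intro sum.cong) auto
    also have "\<dots> = (\<Sum>B\<in>alph P'. s B)" using f(1) by (rule sum.reindex_bij_betw)
    finally show ?thesis by (simp only: state_term_def size)
  qed
  have "(\<Sum>s\<in>states P'. state_term P' s) = (\<Sum>s\<in>states P. state_term P s)"
  proof (rule sum.reindex_bij_witness[where i = ?push and j = ?pull])
    fix s assume s: "s \<in> states P'"
    show "?push (?pull s) = s"
    proof
      fix B
      show "?push (?pull s) B = s B"
        using s gB fg by (cases "B \<in> alph P'") (auto simp: states_def PiE_iff extensional_def)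
    qed
    show "?pull s \<in> states P"
      using s fA unfolding states_def by (auto simp: PiE_iff)
    show "state_term P (?pull s) = state_term P' s" using s by (rule term_eq)
  next
    fix s assume s: "s \<in> states P"
    show "?pull (?push s) = s"
    proof
      fix A
      show "?pull (?push s) A = s A"
        using s fA gf by (cases "A \<in> alph P") (auto simp: states_def PiE_iff extensional_def)
    qed
    show "?push s \<in> states P'"
      using s gB unfolding states_def by (auto simp: PiE_iff)
  qed
  moreover have "writhe P = writhe P'"
  proof -
    have "writhe P = (\<Sum>A\<in>alph P. proj P' (f A))"
      unfolding writhe_def using f(2) by (intro sum.cong) auto
    also have "\<dots> = writhe P'" unfolding writhe_def using f(1) by (rule sum.reindex_bij_betw)
    finally show ?thesis .
  qed
  ultimately show ?thesis
    unfolding jones_state_terms[OF fin(1)] jones_state_terms[OF fin(2)] by (simp only:)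
qed

lemma jones_move:
  assumes "move uminus (S_sharp {- 1, 1} uminus id) P P'"
    and "nanophrase {-1, 1} P" "nanophrase {-1, 1} P'"
  shows "jones P = jones P'"
  using assms
proof (induction P P' rule: move.induct)
  case (H1 ws x A y ws' \<A> p)
  show ?case by (rule jones_H1[OF H1(3,4,1,2)])
next
  case (H2 ws x A B y z ws' p \<A>)
  show ?case by (rule jones_H2[OF H2(4,5,1,2)]) (use H2(3) in simp)
next
  case (H3 ws x A B y C z t ws' p \<A>)
  show ?case by (rule jones_H3[OF H3(4,5,1,2,3)])
qed

section \<open>Passing to signs\<close>

text \<open>The phrase over \<open>{1, - 1}\<close> whose Jones polynomial is \<open>jones_star\<close> of \<open>F_star\<close>.\<close>

definition sign_phrase :: "('a \<Rightarrow> 'a) \<Rightarrow> ('a \<Rightarrow> 'a) \<Rightarrow> 'a set \<Rightarrow> ('l, 'a) phrase \<Rightarrow> ('l, int) phrase" where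
  "sign_phrase \<tau> \<nu> L P =
     Phrase (alph (F_star \<tau> \<nu> L P)) (star_sign \<circ> proj (F_star \<tau> \<nu> L P)) (comps (F_star \<tau> \<nu> L P))"

text \<open>The projections that \<open>F_star\<close> sends to \<open>a_plus\<close> or \<open>b_plus\<close>.\<close>

definition positive :: "('a \<Rightarrow> 'a) \<Rightarrow> ('a \<Rightarrow> 'a) \<Rightarrow> 'a set \<Rightarrow> 'a set" where
  "positive \<tau> \<nu> L = L_star \<tau> \<nu> L \<union> \<nu> ` L_star \<tau> \<nu> L"

lemma sign_phrase_eq:
  "sign_phrase \<tau> \<nu> L (Phrase \<A> p ws) =
     Phrase {A \<in> \<A>. p A \<in> eta_star \<tau> \<nu> L} (\<lambda>A. if p A \<in> positive \<tau> \<nu> L then 1 else - 1)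
       (map (filter (\<lambda>A. p A \<in> eta_star \<tau> \<nu> L)) ws)"
  by (auto simp: sign_phrase_def F_star_def positive_def fun_eq_iff)

lemma nanophrase_sign_phrase:
  fixes P :: "('l, 'a) phrase"
  assumes "nanophrase \<alpha> P"
  shows "nanophrase {-1, 1} (sign_phrase \<tau> \<nu> L P)"
proof (cases P)
  case (Phrase \<A> p ws)
  have "count_list (filter Q xs) A = count_list xs A" if "Q A" for Q xs and A :: 'l
    using that by (induction xs) auto
  moreover have "concat (map (filter Q) ws) = filter Q (concat ws)" for Q
    by (simp add: filter_concat)
  ultimately show ?thesis
    using assms by (auto simp: Phrase sign_phrase_eq nanophrase_def)
qed

locale two_involutions =
  fixes \<alpha> L :: "'a set" and \<tau> \<nu> :: "'a \<Rightarrow> 'a"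
  assumes tau: "involution_on \<alpha> \<tau>" and nu: "involution_on \<alpha> \<nu>"
    and commute: "\<forall>a\<in>\<alpha>. \<tau> (\<nu> a) = \<nu> (\<tau> a)"
    and reps: "representatives \<alpha> \<tau> \<nu> L"
begin

abbreviation "pos \<equiv> positive \<tau> \<nu> L"
abbreviation "eta \<equiv> eta_star \<tau> \<nu> L"

lemma closed: "a \<in> \<alpha> \<Longrightarrow> \<tau> a \<in> \<alpha>" "a \<in> \<alpha> \<Longrightarrow> \<nu> a \<in> \<alpha>"
  and cancel: "a \<in> \<alpha> \<Longrightarrow> \<tau> (\<tau> a) = a" "a \<in> \<alpha> \<Longrightarrow> \<nu> (\<nu> a) = a"
  using tau nu by (auto simp: involution_on_def)

lemma L_star_alpha: "l \<in> L_star \<tau> \<nu> L \<Longrightarrow> l \<in> \<alpha>"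
  using reps by (auto simp: L_star_def representatives_def)

lemma positive_alpha: "a \<in> pos \<Longrightarrow> a \<in> \<alpha>"
  using L_star_alpha closed by (auto simp: positive_def)

lemma eta_eq: "eta = pos \<union> \<tau> ` pos"
  by (auto simp: eta_star_def positive_def image_Un image_image)

lemma nu_positive: "a \<in> pos \<Longrightarrow> \<nu> a \<in> pos"
  using L_star_alpha cancel by (auto simp: positive_def)

lemma orbit_tau: "a \<in> \<alpha> \<Longrightarrow> orbit_equiv \<alpha> \<tau> \<nu> (\<tau> a) a"
  and orbit_nu: "a \<in> \<alpha> \<Longrightarrow> orbit_equiv \<alpha> \<tau> \<nu> (\<nu> a) a"
  unfolding orbit_equiv_def by (rule equivclp_sym, rule r_into_equivclp, simp)+

lemma orbit_trans: "orbit_equiv \<alpha> \<tau> \<nu> a b \<Longrightarrow> orbit_equiv \<alpha> \<tau> \<nu> b c \<Longrightarrow> orbit_equiv \<alpha> \<tau> \<nu> a c"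
  unfolding orbit_equiv_def by (rule equivclp_trans)

lemma orbit_sym: "orbit_equiv \<alpha> \<tau> \<nu> a b \<Longrightarrow> orbit_equiv \<alpha> \<tau> \<nu> b a"
  unfolding orbit_equiv_def by (rule equivclp_sym)

lemma representative_unique:
  assumes "l \<in> L_star \<tau> \<nu> L" "l' \<in> L_star \<tau> \<nu> L" "orbit_equiv \<alpha> \<tau> \<nu> l l'"
  shows "l = l'"
proof -
  have "orbit_equiv \<alpha> \<tau> \<nu> l l" by (simp add: orbit_equiv_def)
  thus ?thesis
    using assms reps L_star_alpha unfolding representatives_def L_star_def by blast
qed

text \<open>If \<open>a = \<tau> b\<close>, then \<open>a\<close> and \<open>b\<close> belong to the orbit of one representative \<open>l\<close>, and \<open>l\<close> would be
  fixed by \<open>\<tau>\<close> or \<open>\<nu>\<close> or have \<open>\<tau> l = \<nu> l\<close>; these are the representatives excluded from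
  \<open>L_star\<close>.\<close>

lemma tau_positive_disjoint:
  assumes "a \<in> pos" "b \<in> pos"
  shows "a \<noteq> \<tau> b"
proof
  assume eq: "a = \<tau> b"
  obtain l where l: "l \<in> L_star \<tau> \<nu> L" "a = l \<or> a = \<nu> l" using assms(1) by (auto simp: positive_def)
  obtain l' where l': "l' \<in> L_star \<tau> \<nu> L" "b = l' \<or> b = \<nu> l'" using assms(2) by (auto simp: positive_def)
  note \<alpha> = L_star_alpha[OF l(1)] L_star_alpha[OF l'(1)] positive_alpha[OF assms(2)]
  have refl: "orbit_equiv \<alpha> \<tau> \<nu> c c" for c by (simp add: orbit_equiv_def)
  have "orbit_equiv \<alpha> \<tau> \<nu> l a" using l(2) orbit_nu[OF \<alpha>(1)] orbit_sym refl by metis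
  moreover have "orbit_equiv \<alpha> \<tau> \<nu> a b" unfolding eq using orbit_tau[OF \<alpha>(3)] .
  moreover have "orbit_equiv \<alpha> \<tau> \<nu> b l'" using l'(2) orbit_nu[OF \<alpha>(2)] refl by metis
  ultimately have "l = l'" using representative_unique l(1) l'(1) orbit_trans by metis
  hence "l = \<tau> l \<or> l = \<tau> (\<nu> l) \<or> \<nu> l = \<tau> l \<or> \<nu> l = \<tau> (\<nu> l)"
    using eq l(2) l'(2) by auto
  hence "l = \<tau> l \<or> \<tau> l = \<nu> l \<or> \<nu> l = l"
    using cancel closed \<alpha>(1) commute by metis
  thus False using l(1) by (auto simp: L_star_def)
qed

lemma positive_tau:
  assumes "a \<in> \<alpha>" "a \<in> eta"
  shows "\<tau> a \<in> pos \<longleftrightarrow> a \<notin> pos"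
proof (cases "a \<in> pos")
  case True
  thus ?thesis using tau_positive_disjoint by blast
next
  case False
  then obtain b where "b \<in> pos" "a = \<tau> b" using assms(2) eta_eq by auto
  thus ?thesis using False cancel(1) positive_alpha by metis
qed

lemma eta_tau: "a \<in> \<alpha> \<Longrightarrow> \<tau> a \<in> eta \<longleftrightarrow> a \<in> eta"
proof -
  have *: "\<tau> a \<in> eta" if "a \<in> eta" for a
    using that cancel(1) positive_alpha unfolding eta_eq by auto
  show "a \<in> \<alpha> \<Longrightarrow> \<tau> a \<in> eta \<longleftrightarrow> a \<in> eta" using * cancel(1) by metis
qed

lemma eta_nu: "a \<in> \<alpha> \<Longrightarrow> \<nu> a \<in> eta \<longleftrightarrow> a \<in> eta"
proof -
  have *: "\<nu> a \<in> eta" if a: "a \<in> eta" for a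
  proof (cases "a \<in> pos")
    case True
    thus ?thesis using nu_positive by (auto simp: eta_eq)
  next
    case False
    then obtain b where b: "b \<in> pos" "a = \<tau> b" using a eta_eq by auto
    hence "\<nu> a = \<tau> (\<nu> b)" using commute positive_alpha by simp
    thus ?thesis using nu_positive[OF b(1)] by (auto simp: eta_eq)
  qed
  show "a \<in> \<alpha> \<Longrightarrow> \<nu> a \<in> eta \<longleftrightarrow> a \<in> eta" using * cancel(2) by metis
qed

lemma positive_nu: "a \<in> \<alpha> \<Longrightarrow> \<nu> a \<in> pos \<longleftrightarrow> a \<in> pos"
  using nu_positive cancel(2) by metis

lemma positive_nu_tau:
  assumes "a \<in> \<alpha>" "a \<in> eta"
  shows "\<nu> (\<tau> a) \<in> pos \<longleftrightarrow> a \<notin> pos"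
  using positive_tau[OF assms] positive_nu[OF closed(1)[OF assms(1)]] by simp

lemma eta_nu_tau: "a \<in> \<alpha> \<Longrightarrow> \<nu> (\<tau> a) \<in> eta \<longleftrightarrow> a \<in> eta"
  using eta_nu eta_tau closed by simp

end

lemma barred_filter:
  "barred (map (filter Q) ws) = filter (\<lambda>u. case u of None \<Rightarrow> True | Some A \<Rightarrow> Q A) (barred ws)"
proof -
  have w: "filter (\<lambda>u. case u of None \<Rightarrow> True | Some A \<Rightarrow> Q A) (map Some w) = map Some (filter Q w)" for w
    by (induction w) auto
  show ?thesis by (induction ws rule: barred.induct) (simp_all add: w)
qed

text \<open>If all letters of a move are deleted, the two barred words become equal; the phrases are equal as
  well, because the words between separators can be recovered.\<close>

lemma barred_inject:
  assumes "barred ws = barred ws'" "ws \<noteq> []" "ws' \<noteq> []"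
  shows "ws = ws'"
  using assms
proof (induction ws arbitrary: ws' rule: barred.induct)
  case (2 w)
  show ?case
  proof (cases ws' rule: barred.cases)
    case (2 w')
    thus ?thesis using "2.prems" by (simp add: inj_map_eq_map)
  next
    case (3 w' v' vs')
    have "None \<notin> set (map Some w)" by auto
    thus ?thesis using "2.prems" 3 by (metis barred.simps(2,3) in_set_conv_decomp)
  qed (use "2.prems" in simp)
next
  case (3 w v ws)
  show ?case
  proof (cases ws' rule: barred.cases)
    case (2 w')
    have "None \<notin> set (map Some w')" by auto
    thus ?thesis using "3.prems" 2 by (metis barred.simps(2,3) in_set_conv_decomp)
  next
    case c: (3 w' v' vs')
    have "map Some w = map Some w' \<and> barred (v # ws) = barred (v' # vs')"
    proof -
      have eq: "map Some w @ None # barred (v # ws) = map Some w' @ None # barred (v' # vs')"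
        using "3.prems"(1) c by simp
      have tw: "takeWhile (\<lambda>u. u \<noteq> None) (map Some w @ None # q) = map Some w"
        and dw: "dropWhile (\<lambda>u. u \<noteq> None) (map Some w @ None # q) = None # q" for w :: "'a list" and q
        by (induction w) auto
      from arg_cong[OF eq, of "takeWhile (\<lambda>u. u \<noteq> None)"]
        arg_cong[OF eq, of "dropWhile (\<lambda>u. u \<noteq> None)"]
      show ?thesis unfolding tw dw by simp
    qed
    thus ?thesis using "3.IH"[of "v' # vs'"] c by (simp add: inj_map_eq_map)
  qed (use "3.prems" in simp)
qed simp

context two_involutions
begin

text \<open>The letters displayed in a move are all kept or all deleted, since their projections
  are equal or related by \<open>\<tau>\<close> or \<open>\<nu> \<tau>\<close>, and both maps preserve \<open>eta\<close>. If the letters are kept, both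
  maps negate signs, as \<open>uminus\<close> does.\<close>

lemma sign_phrase_move:
  assumes "move \<tau> (S_sharp \<alpha> \<tau> \<nu>) P P'" and "nanophrase \<alpha> P" "nanophrase \<alpha> P'"
  shows "sign_phrase \<tau> \<nu> L P = sign_phrase \<tau> \<nu> L P' \<or>
    move uminus (S_sharp {- 1, 1} uminus id) (sign_phrase \<tau> \<nu> L P) (sign_phrase \<tau> \<nu> L P')"
  using assms
proof (induction P P' rule: move.induct)
  case (H1 ws x A y ws' \<A> p)
  define F where "F = filter (\<lambda>u. case u of None \<Rightarrow> True | Some A \<Rightarrow> p A \<in> eta)"
  let ?ws = "map (filter (\<lambda>A. p A \<in> eta)) ws" and ?ws' = "map (filter (\<lambda>A. p A \<in> eta)) ws'"
  have b: "barred ?ws = F (barred ws)" "barred ?ws' = F (barred ws')"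
    by (simp_all add: barred_filter F_def)
  show ?case
  proof (cases "p A \<in> eta")
    case True
    hence "barred ?ws = F x @ [Some A, Some A] @ F y" "barred ?ws' = F x @ F y"
      unfolding b H1(1,2) by (simp_all add: F_def)
    from move.H1[OF this] have "move uminus (S_sharp {- 1, 1} uminus id)
      (Phrase {A \<in> \<A>. p A \<in> eta} q ?ws) (Phrase ({A \<in> \<A>. p A \<in> eta} - {A}) q ?ws')" for q :: "_ \<Rightarrow> int" .
    moreover have "{A \<in> \<A>. p A \<in> eta} - {A} = {B \<in> \<A> - {A}. p B \<in> eta}" by blast
    ultimately show ?thesis unfolding sign_phrase_eq by (simp only: simp_thms)
  next
    case False
    hence "barred ?ws = barred ?ws'"
      unfolding b H1(1,2) by (simp add: F_def)
    hence "?ws = ?ws'"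
      by (rule barred_inject) (use H1(3,4) in \<open>simp_all add: nanophrase_def\<close>)
    moreover have "{A \<in> \<A>. p A \<in> eta} = {B \<in> \<A> - {A}. p B \<in> eta}" using False by blast
    ultimately show ?thesis unfolding sign_phrase_eq by (simp only: simp_thms)
  qed
next
  case (H2 ws x A B y z ws' p \<A>)
  define F where "F = filter (\<lambda>u. case u of None \<Rightarrow> True | Some A \<Rightarrow> p A \<in> eta)"
  let ?ws = "map (filter (\<lambda>A. p A \<in> eta)) ws" and ?ws' = "map (filter (\<lambda>A. p A \<in> eta)) ws'"
  have b: "barred ?ws = F (barred ws)" "barred ?ws' = F (barred ws')"
    by (simp_all add: barred_filter F_def)
  have pA: "p A \<in> \<alpha>" by (rule nanophrase_letters(2)[OF H2(4)]) (simp add: H2(1))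
  have iff: "p B \<in> eta \<longleftrightarrow> p A \<in> eta" using eta_tau[OF pA] H2(3) by simp
  show ?case
  proof (cases "p A \<in> eta")
    case True
    define q where "q = (\<lambda>X. if p X \<in> pos then 1 else - 1 :: int)"
    have "barred ?ws = F x @ [Some A, Some B] @ F y @ [Some B, Some A] @ F z" "barred ?ws' = F x @ F y @ F z"
      unfolding b H2(1,2) using iff True by (simp_all add: F_def)
    moreover have "- q A = q B"
      using positive_tau[OF pA True] H2(3) by (simp add: q_def)
    ultimately have "move uminus (S_sharp {- 1, 1} uminus id)
      (Phrase {A \<in> \<A>. p A \<in> eta} q ?ws)
      (Phrase ({A \<in> \<A>. p A \<in> eta} - {A, B}) q ?ws')"
      by (rule move.H2)
    moreover have "{A \<in> \<A>. p A \<in> eta} - {A, B} = {X \<in> \<A> - {A, B}. p X \<in> eta}" by blast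
    ultimately show ?thesis unfolding sign_phrase_eq q_def by (simp only: simp_thms)
  next
    case False
    hence "barred ?ws = barred ?ws'"
      unfolding b H2(1,2) using iff by (simp add: F_def)
    hence "?ws = ?ws'"
      by (rule barred_inject) (use H2(4,5) in \<open>simp_all add: nanophrase_def\<close>)
    moreover have "{A \<in> \<A>. p A \<in> eta} = {X \<in> \<A> - {A, B}. p X \<in> eta}" using False iff by blast
    ultimately show ?thesis unfolding sign_phrase_eq by (simp only: simp_thms)
  qed
next
  case (H3 ws x A B y C z t ws' p \<A>)
  define F where "F = filter (\<lambda>u. case u of None \<Rightarrow> True | Some A \<Rightarrow> p A \<in> eta)"
  let ?ws = "map (filter (\<lambda>A. p A \<in> eta)) ws" and ?ws' = "map (filter (\<lambda>A. p A \<in> eta)) ws'"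
  have b: "barred ?ws = F (barred ws)" "barred ?ws' = F (barred ws')"
    by (simp_all add: barred_filter F_def)
  obtain a where a: "a \<in> \<alpha>" "p A = a" "p B = a \<and> p C = a \<or> p B = a \<and> p C = \<nu> (\<tau> a) \<or>
      p B = \<nu> (\<tau> a) \<and> p C = \<nu> (\<tau> a)"
    using H3(3) unfolding S_sharp_def by auto
  have iff: "p B \<in> eta \<longleftrightarrow> p A \<in> eta" "p C \<in> eta \<longleftrightarrow> p A \<in> eta"
    using a eta_nu_tau[OF a(1)] by auto
  show ?case
  proof (cases "p A \<in> eta")
    case True
    define q where "q = (\<lambda>X. if p X \<in> pos then 1 else - 1 :: int)"
    have "barred ?ws = F x @ [Some A, Some B] @ F y @ [Some A, Some C] @ F z @ [Some B, Some C] @ F t"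
      "barred ?ws' = F x @ [Some B, Some A] @ F y @ [Some C, Some A] @ F z @ [Some C, Some B] @ F t"
      unfolding b H3(1,2) using iff True by (simp_all add: F_def)
    moreover have "(q A, q B, q C) \<in> S_sharp {- 1, 1} uminus id"
      using positive_nu_tau[OF a(1)] True a by (auto simp: S_sharp_def q_def)
    ultimately have "move uminus (S_sharp {- 1, 1} uminus id)
      (Phrase {A \<in> \<A>. p A \<in> eta} q ?ws)
      (Phrase {A \<in> \<A>. p A \<in> eta} q ?ws')"
      by (rule move.H3)
    thus ?thesis unfolding sign_phrase_eq q_def by (simp only: simp_thms)
  next
    case False
    hence "barred ?ws = barred ?ws'"
      unfolding b H3(1,2) using iff by (simp add: F_def)
    hence "?ws = ?ws'"
      by (rule barred_inject) (use H3(4,5) in \<open>simp_all add: nanophrase_def\<close>)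
    thus ?thesis unfolding sign_phrase_eq by (simp only: simp_thms)
  qed
qed

end

lemma sign_phrase_isomorphic:
  assumes "isomorphic P P'" "nanophrase \<alpha> P"
  shows "isomorphic (sign_phrase \<tau> \<nu> L P) (sign_phrase \<tau> \<nu> L P')"
proof (cases P; cases P')
  fix \<A> p ws \<A>' p' ws' assume P: "P = Phrase \<A> p ws" and P': "P' = Phrase \<A>' p' ws'"
  let ?\<eta> = "eta_star \<tau> \<nu> L"
  obtain f where f: "bij_betw f \<A> \<A>'" "\<And>A. A \<in> \<A> \<Longrightarrow> p' (f A) = p A" "ws' = map (map f) ws"
    using assms(1) unfolding isomorphic_def P P' by auto
  have bij: "bij_betw f {A \<in> \<A>. p A \<in> ?\<eta>} {A \<in> \<A>'. p' A \<in> ?\<eta>}"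
    using f(1,2) unfolding bij_betw_def by (auto simp: inj_on_def)
  have sub: "A \<in> \<A>" if "w \<in> set ws" "A \<in> set w" for A w
    using assms(2) that unfolding nanophrase_def P by auto
  have "filter (\<lambda>A. p' A \<in> ?\<eta>) (map f w) = map f (filter (\<lambda>A. p A \<in> ?\<eta>) w)" if "w \<in> set ws" for w
    using sub[OF that] f(2) by (auto simp: filter_map comp_def intro!: arg_cong[of _ _ "map f"] filter_cong)
  hence "map (filter (\<lambda>A. p' A \<in> ?\<eta>)) ws' = map (map f) (map (filter (\<lambda>A. p A \<in> ?\<eta>)) ws)"
    by (simp add: f(3))
  with bij f(2) show ?thesis
    unfolding isomorphic_def P P' sign_phrase_eq by auto
qed

theorem corollary1:
  fixes \<alpha> L :: "'a set" and \<tau> \<nu> :: "'a \<Rightarrow> 'a" and P P' :: "('l, 'a) phrase"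
  assumes "finite \<alpha>"
    and "involution_on \<alpha> \<tau>" and "involution_on \<alpha> \<nu>"
    and "\<forall>a\<in>\<alpha>. \<tau> (\<nu> a) = \<nu> (\<tau> a)"
    and "representatives \<alpha> \<tau> \<nu> L"
    and "nanophrase \<alpha> P" and "nanophrase \<alpha> P'"
    and "homotopic \<alpha> \<tau> (S_sharp \<alpha> \<tau> \<nu>) P P'"
  shows "jones_star (F_star \<tau> \<nu> L P) = jones_star (F_star \<tau> \<nu> L P')"
proof -
  interpret two_involutions \<alpha> L \<tau> \<nu>
    using assms(2-5) by unfold_locales
  have step: "jones (sign_phrase \<tau> \<nu> L Q) = jones (sign_phrase \<tau> \<nu> L Q')"
    if Q: "nanophrase \<alpha> Q" "nanophrase \<alpha> Q'" and "isomorphic Q Q' \<or> move \<tau> (S_sharp \<alpha> \<tau> \<nu>) Q Q'"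
    for Q Q' :: "('l, 'a) phrase"
    using that(3)
  proof
    assume "isomorphic Q Q'"
    thus ?thesis
      using sign_phrase_isomorphic Q jones_isomorphic nanophrase_sign_phrase by metis
  next
    assume "move \<tau> (S_sharp \<alpha> \<tau> \<nu>) Q Q'"
    from sign_phrase_move[OF this Q] show ?thesis
      using jones_move nanophrase_sign_phrase[OF Q(1)] nanophrase_sign_phrase[OF Q(2)] by metis
  qed
  have "jones (sign_phrase \<tau> \<nu> L P) = jones (sign_phrase \<tau> \<nu> L P')"
    using assms(8) unfolding homotopic_def
    by (induction rule: equivclp_induct) (use step in metis)+
  thus ?thesis by (simp add: jones_star_def sign_phrase_def)
qed

end
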